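(* Let $w_1(s)$, $w_2(s)$ be linearly independent solutions of the hypergeometric differential equation $$s(1-s)w''+(c-(a+b+1)s)w'-ab\,w=0$$ with $(a,b,c)$ one of $$\left(-\tfrac14,\tfrac5{12},\tfrac12\right),\qquad\left(-\tfrac14,\tfrac5{12},\tfrac23\right),\qquad\left(-\tfrac12,\tfrac56,\tfrac23\right).$$ On the 5-manifold $M_{xyzps}$ with coordinates $(x,y,z,p,s)$ let $$\omega_1=dy-p\,dx,\qquad \omega_2=dp-\left(\int(w_1)^2(w_1\dot w_2-w_2\dot w_1)ds\right)dx,$$ $$\omega_3=dz-\left(\frac{w_2}{w_1}\int(w_1)^2(w_1\dot w_2-w_2\dot w_1)ds-\int\left(\int(w_1)^2(w_1\dot w_2-w_2\dot w_1)ds\right)\frac{w_1\dot w_2-w_2\dot w_1}{(w_1)^2}ds\right)dx,$$ $$\omega_4=(w_1)^2(w_1\dot w_2-w_2\dot w_1)ds,\qquad \omega_5=dx,$$ and $$\theta^1=\omega_1-(w_1)^4\left(\frac{w_2}{w_1}\omega_2-\omega_3\right),\qquad \theta^2=(w_1)^4\left(\frac{w_2}{w_1}\omega_2-\omega_3\right),$$ $$\theta^3=\left(1+\frac{w_2\dot w_1}{w_1\dot w_2-w_2\dot w_1}\right)\omega_2-\frac{w_1\dot w_1}{w_1\dot w_2-w_2\dot w_1}\omega_3,$$ $$\theta^4=\frac{2(\ddot w_1\dot w_2-\ddot w_2\dot w_1)}{5(w_1\dot w_2-w_2\dot w_1)^3}\left(\frac{w_2}{w_1}\omega_2-\omega_3\right)+\omega_4-\omega_5,\qquad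 \theta^5=-\omega_4.$$ Then the Nurowski metrics $$g=2\theta^1\theta^5-2\theta^2\theta^4+\frac43\theta^3\theta^3$$ so obtained are all conformally flat. For each $(a,b,c)$ there is a 4-dimensional family of solutions (the choices of the pair $(w_1,w_2)$). Up to fractional linear transformation in the variable $s$ there are 2 distinct classes, given by the last two triples $(a,b,c)$ in the list.
   Context: Dots denote $d/ds$; the integrals denote antiderivatives, with the same choice of $\int(w_1)^2(w_1\dot w_2-w_2\dot w_1)ds$ used throughout. All statements are local, on open sets where all functions involved are real, smooth and well defined (in particular $s\ne0,1$, $w_1\neq0$, $w_1\dot w_2-w_2\dot w_1\neq0$). Products of 1-forms are symmetric products, $\theta\eta=\frac12(\theta\otimes\eta+\eta\otimes\theta)$. Conformally flat means that the Weyl tensor vanishes. The classification "up to fractional linear transformation" refers to the hypergeometric equations for the three triples: two of them are in the same class if a fractional linear change of the variable $s$ (permuting $0,1,\infty$) carries the solutions of one equation to the solutions of the other (up to multiplication by powers of $s$ and $1-s$). *)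

theory Defs
  imports "HOL-Analysis.Analysis"
begin

section \<open>The hypergeometric equation\<close>

definition hg_interval :: "real set \<Rightarrow> bool" where
  "hg_interval J \<longleftrightarrow> open J \<and> is_interval J \<and> J \<noteq> {} \<and> 0 \<notin> J \<and> 1 \<notin> J"

text \<open>Only the values on the open set \<open>J\<close> matter. Twice differentiable solutions are smooth on
  \<open>J\<close>, since \<open>s (1 - s)\<close> has no zero there.\<close>

definition hg_solution :: "real \<times> real \<times> real \<Rightarrow> real set \<Rightarrow> (real \<Rightarrow> real) \<Rightarrow> bool" where
  "hg_solution T J w \<longleftrightarrow> (case T of (a, b, c) \<Rightarrow>
     (\<forall>s\<in>J. w field_differentiable (at s) \<and> deriv w field_differentiable (at s) \<and>
        s * (1 - s) * deriv (deriv w) s + (c - (a + b + 1) * s) * deriv w s - a * b * w s = 0))"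

definition lin_indep_on :: "real set \<Rightarrow> (real \<Rightarrow> real) \<Rightarrow> (real \<Rightarrow> real) \<Rightarrow> bool" where
  "lin_indep_on J u v \<longleftrightarrow>
     (\<forall>\<alpha> \<beta>. (\<forall>s\<in>J. \<alpha> * u s + \<beta> * v s = 0) \<longrightarrow> \<alpha> = 0 \<and> \<beta> = 0)"

definition hg_pairs :: "real \<times> real \<times> real \<Rightarrow> real set \<Rightarrow> ((real \<Rightarrow> real) \<times> (real \<Rightarrow> real)) set" where
  "hg_pairs T J = {(u, v). hg_solution T J u \<and> hg_solution T J v \<and> lin_indep_on J u v}"

definition hg_triples :: "(real \<times> real \<times> real) set" where
  "hg_triples = {(- 1/4, 5/12, 1/2), (- 1/4, 5/12, 2/3), (- 1/2, 5/6, 2/3)}"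

text \<open>A set of pairs of functions on \<open>J\<close> is a 4-dimensional family if it is parametrised
  bijectively, up to the irrelevant values outside \<open>J\<close>, by a nonempty open set of parameters in
  \<open>\<real>\<^sup>4\<close>, the pair depending linearly on the parameters.\<close>

definition four_dim_family :: "real set \<Rightarrow> ((real \<Rightarrow> real) \<times> (real \<Rightarrow> real)) set \<Rightarrow> bool" where
  "four_dim_family J F \<longleftrightarrow>
     (\<exists>(\<Phi> :: real^4 \<Rightarrow> real \<Rightarrow> real) (\<Psi> :: real^4 \<Rightarrow> real \<Rightarrow> real) U.
        open U \<and> U \<noteq> {} \<and>
        (\<forall>s\<in>J. linear (\<lambda>t. \<Phi> t s) \<and> linear (\<lambda>t. \<Psi> t s)) \<and>
        (\<forall>t\<in>U. (\<Phi> t, \<Psi> t) \<in> F) \<and>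
        (\<forall>(u, v)\<in>F. \<exists>!t. t \<in> U \<and> (\<forall>s\<in>J. u s = \<Phi> t s \<and> v s = \<Psi> t s)))"

text \<open>The map \<open>s \<mapsto> (\<alpha> s + \<beta>) / (\<gamma> s + \<delta>)\<close> permutes \<open>0, 1, \<infinity>\<close>. In homogeneous coordinates
  these points are \<open>[0:1], [1:1], [1:0]\<close>; an invertible matrix that maps the set of the three points
  into itself permutes them.\<close>

definition marked_point :: "real \<Rightarrow> real \<Rightarrow> bool" where
  "marked_point x y \<longleftrightarrow> x = 0 \<or> y = 0 \<or> x = y"

definition permutes_singular_points :: "real \<Rightarrow> real \<Rightarrow> real \<Rightarrow> real \<Rightarrow> bool" where
  "permutes_singular_points \<alpha> \<beta> \<gamma> \<delta> \<longleftrightarrow> \<alpha> * \<delta> - \<beta> * \<gamma> \<noteq> 0 \<and>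
     marked_point \<beta> \<delta> \<and> marked_point (\<alpha> + \<beta>) (\<gamma> + \<delta>) \<and> marked_point \<alpha> \<gamma>"

text \<open>Two triples are related if a fractional linear change of variable \<open>\<phi>\<close>, followed by
  multiplication with \<open>\<bar>s\<bar>\<^sup>e \<bar>1 - s\<bar>\<^sup>f\<close>, carries the solutions on \<open>\<phi> ` J\<close> of the first equation
  exactly to the solutions on \<open>J\<close> of the second one.\<close>

definition hg_related :: "real set \<Rightarrow> real \<times> real \<times> real \<Rightarrow> real \<times> real \<times> real \<Rightarrow> bool" where
  "hg_related J T T' \<longleftrightarrow>
     (\<exists>\<alpha> \<beta> \<gamma> \<delta> e f. permutes_singular_points \<alpha> \<beta> \<gamma> \<delta> \<and>
        (let \<phi> = (\<lambda>s. (\<alpha> * s + \<beta>) / (\<gamma> * s + \<delta>)) in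
          \<forall>w. hg_solution T (\<phi> ` J) w \<longleftrightarrow>
              hg_solution T' J (\<lambda>s. \<bar>s\<bar> powr e * \<bar>1 - s\<bar> powr f * w (\<phi> s))))"

definition hg_class :: "real set \<Rightarrow> ((real \<times> real \<times> real) \<times> (real \<times> real \<times> real)) set" where
  "hg_class J = {(T, T'). T \<in> hg_triples \<and> T' \<in> hg_triples \<and> hg_related J T T'}"


section \<open>The Weyl tensor in coordinates\<close>

type_synonym 'n metric = "real^'n \<Rightarrow> real^'n^'n"

definition partial :: "'n::finite \<Rightarrow> (real^'n \<Rightarrow> real) \<Rightarrow> real^'n \<Rightarrow> real" where
  "partial i f q = deriv (\<lambda>t. f (q + t *\<^sub>R axis i 1)) 0"

definition pseudo_metric_on :: "(real^'n) set \<Rightarrow> 'n::finite metric \<Rightarrow> bool" where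
  "pseudo_metric_on U g \<longleftrightarrow> (\<forall>q\<in>U. transpose (g q) = g q \<and> invertible (g q))"

definition christoffel :: "'n::finite metric \<Rightarrow> 'n \<Rightarrow> 'n \<Rightarrow> 'n \<Rightarrow> real^'n \<Rightarrow> real" where
  "christoffel g i j k q =
     (\<Sum>m\<in>UNIV. matrix_inv (g q) $ i $ m *
        (partial j (\<lambda>r. g r $ m $ k) q + partial k (\<lambda>r. g r $ m $ j) q
         - partial m (\<lambda>r. g r $ j $ k) q)) / 2"

text \<open>\<open>riemann g i j k l\<close> is \<open>R\<^sup>i\<^sub>j\<^sub>k\<^sub>l\<close>, normalised such that the round sphere has
  \<open>R\<^sub>i\<^sub>j\<^sub>k\<^sub>l = g\<^sub>i\<^sub>k g\<^sub>j\<^sub>l - g\<^sub>i\<^sub>l g\<^sub>j\<^sub>k\<close>.\<close>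

definition riemann :: "'n::finite metric \<Rightarrow> 'n \<Rightarrow> 'n \<Rightarrow> 'n \<Rightarrow> 'n \<Rightarrow> real^'n \<Rightarrow> real" where
  "riemann g i j k l q =
     partial k (christoffel g i l j) q - partial l (christoffel g i k j) q
     + (\<Sum>m\<in>UNIV. christoffel g i k m q * christoffel g m l j q
                 - christoffel g i l m q * christoffel g m k j q)"

definition riemann_low :: "'n::finite metric \<Rightarrow> 'n \<Rightarrow> 'n \<Rightarrow> 'n \<Rightarrow> 'n \<Rightarrow> real^'n \<Rightarrow> real" where
  "riemann_low g i j k l q = (\<Sum>m\<in>UNIV. g q $ i $ m * riemann g m j k l q)"

definition ricci :: "'n::finite metric \<Rightarrow> 'n \<Rightarrow> 'n \<Rightarrow> real^'n \<Rightarrow> real" where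
  "ricci g j l q = (\<Sum>i\<in>UNIV. riemann g i j i l q)"

definition scalar_curv :: "'n::finite metric \<Rightarrow> real^'n \<Rightarrow> real" where
  "scalar_curv g q = (\<Sum>j\<in>UNIV. \<Sum>l\<in>UNIV. matrix_inv (g q) $ j $ l * ricci g j l q)"

definition weyl :: "'n::finite metric \<Rightarrow> 'n \<Rightarrow> 'n \<Rightarrow> 'n \<Rightarrow> 'n \<Rightarrow> real^'n \<Rightarrow> real" where
  "weyl g i j k l q = (let n = real CARD('n) in
     riemann_low g i j k l q
     - (g q $ i $ k * ricci g j l q - g q $ i $ l * ricci g j k q
        - g q $ j $ k * ricci g i l q + g q $ j $ l * ricci g i k q) / (n - 2)
     + scalar_curv g q * (g q $ i $ k * g q $ j $ l - g q $ i $ l * g q $ j $ k)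
       / ((n - 1) * (n - 2)))"

definition conformally_flat_on :: "(real^'n) set \<Rightarrow> 'n::finite metric \<Rightarrow> bool" where
  "conformally_flat_on U g \<longleftrightarrow> (\<forall>q\<in>U. \<forall>i j k l. weyl g i j k l q = 0)"


section \<open>The coframe and the metric\<close>

text \<open>The coordinates \<open>(x, y, z, p, s)\<close> are the components \<open>1, \<dots>, 5\<close> of a point of \<open>\<real>\<^sup>5\<close>;
  a 1-form at a point is its vector of coefficients with respect to \<open>dx, dy, dz, dp, ds\<close>.\<close>

type_synonym form = "real^5"

abbreviation dx :: form where "dx \<equiv> axis 1 1"
abbreviation dy :: form where "dy \<equiv> axis 2 1"
abbreviation dz :: form where "dz \<equiv> axis 3 1"
abbreviation dp :: form where "dp \<equiv> axis 4 1"
abbreviation ds :: form where "ds \<equiv> axis 5 1"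

definition wronskian :: "(real \<Rightarrow> real) \<Rightarrow> (real \<Rightarrow> real) \<Rightarrow> real \<Rightarrow> real" where
  "wronskian u v s = u s * deriv v s - v s * deriv u s"

text \<open>In the following, \<open>I\<close> is an antiderivative of \<open>w\<^sub>1\<^sup>2 W\<close> and \<open>K\<close> one of \<open>I W / w\<^sub>1\<^sup>2\<close>, where
  \<open>W\<close> is the Wronskian.\<close>

definition antiderivatives_on ::
  "real set \<Rightarrow> (real \<Rightarrow> real) \<Rightarrow> (real \<Rightarrow> real) \<Rightarrow> (real \<Rightarrow> real) \<Rightarrow> (real \<Rightarrow> real) \<Rightarrow> bool" where
  "antiderivatives_on J w1 w2 I K \<longleftrightarrow> (\<forall>s\<in>J.
     (I has_real_derivative (w1 s)\<^sup>2 * wronskian w1 w2 s) (at s) \<and>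
     (K has_real_derivative I s * (wronskian w1 w2 s / (w1 s)\<^sup>2)) (at s))"

definition \<omega>1 :: "real^5 \<Rightarrow> form" where
  "\<omega>1 q = dy - (q $ 4) *\<^sub>R dx"

definition \<omega>2 :: "(real \<Rightarrow> real) \<Rightarrow> real^5 \<Rightarrow> form" where
  "\<omega>2 I q = dp - I (q $ 5) *\<^sub>R dx"

definition \<omega>3 :: "(real \<Rightarrow> real) \<Rightarrow> (real \<Rightarrow> real) \<Rightarrow> (real \<Rightarrow> real) \<Rightarrow> (real \<Rightarrow> real) \<Rightarrow> real^5 \<Rightarrow> form" where
  "\<omega>3 w1 w2 I K q = (let s = q $ 5 in dz - (w2 s / w1 s * I s - K s) *\<^sub>R dx)"

definition \<omega>4 :: "(real \<Rightarrow> real) \<Rightarrow> (real \<Rightarrow> real) \<Rightarrow> real^5 \<Rightarrow> form" where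
  "\<omega>4 w1 w2 q = (let s = q $ 5 in ((w1 s)\<^sup>2 * wronskian w1 w2 s) *\<^sub>R ds)"

definition \<omega>5 :: "real^5 \<Rightarrow> form" where
  "\<omega>5 q = dx"

definition \<theta>1 :: "(real \<Rightarrow> real) \<Rightarrow> (real \<Rightarrow> real) \<Rightarrow> (real \<Rightarrow> real) \<Rightarrow> (real \<Rightarrow> real) \<Rightarrow> real^5 \<Rightarrow> form" where
  "\<theta>1 w1 w2 I K q = (let s = q $ 5 in
     \<omega>1 q - (w1 s ^ 4) *\<^sub>R ((w2 s / w1 s) *\<^sub>R \<omega>2 I q - \<omega>3 w1 w2 I K q))"

definition \<theta>2 :: "(real \<Rightarrow> real) \<Rightarrow> (real \<Rightarrow> real) \<Rightarrow> (real \<Rightarrow> real) \<Rightarrow> (real \<Rightarrow> real) \<Rightarrow> real^5 \<Rightarrow> form" where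
  "\<theta>2 w1 w2 I K q = (let s = q $ 5 in
     (w1 s ^ 4) *\<^sub>R ((w2 s / w1 s) *\<^sub>R \<omega>2 I q - \<omega>3 w1 w2 I K q))"

definition \<theta>3 :: "(real \<Rightarrow> real) \<Rightarrow> (real \<Rightarrow> real) \<Rightarrow> (real \<Rightarrow> real) \<Rightarrow> (real \<Rightarrow> real) \<Rightarrow> real^5 \<Rightarrow> form" where
  "\<theta>3 w1 w2 I K q = (let s = q $ 5 in
     (1 + w2 s * deriv w1 s / wronskian w1 w2 s) *\<^sub>R \<omega>2 I q
     - (w1 s * deriv w1 s / wronskian w1 w2 s) *\<^sub>R \<omega>3 w1 w2 I K q)"

definition \<theta>4 :: "(real \<Rightarrow> real) \<Rightarrow> (real \<Rightarrow> real) \<Rightarrow> (real \<Rightarrow> real) \<Rightarrow> (real \<Rightarrow> real) \<Rightarrow> real^5 \<Rightarrow> form" where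
  "\<theta>4 w1 w2 I K q = (let s = q $ 5 in
     (2 * (deriv (deriv w1) s * deriv w2 s - deriv (deriv w2) s * deriv w1 s)
       / (5 * wronskian w1 w2 s ^ 3)) *\<^sub>R ((w2 s / w1 s) *\<^sub>R \<omega>2 I q - \<omega>3 w1 w2 I K q)
     + \<omega>4 w1 w2 q - \<omega>5 q)"

definition \<theta>5 :: "(real \<Rightarrow> real) \<Rightarrow> (real \<Rightarrow> real) \<Rightarrow> real^5 \<Rightarrow> form" where
  "\<theta>5 w1 w2 q = - \<omega>4 w1 w2 q"

definition sym_prod :: "form \<Rightarrow> form \<Rightarrow> real^5^5" where
  "sym_prod \<theta> \<eta> = (\<chi> i j. (\<theta> $ i * \<eta> $ j + \<eta> $ i * \<theta> $ j) / 2)"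

definition nurowski_metric ::
  "(real \<Rightarrow> real) \<Rightarrow> (real \<Rightarrow> real) \<Rightarrow> (real \<Rightarrow> real) \<Rightarrow> (real \<Rightarrow> real) \<Rightarrow> 5 metric" where
  "nurowski_metric w1 w2 I K q =
     2 *\<^sub>R sym_prod (\<theta>1 w1 w2 I K q) (\<theta>5 w1 w2 q)
     - 2 *\<^sub>R sym_prod (\<theta>2 w1 w2 I K q) (\<theta>4 w1 w2 I K q)
     + (4/3) *\<^sub>R sym_prod (\<theta>3 w1 w2 I K q) (\<theta>3 w1 w2 I K q)"

end

theory Submission
  imports Defs
begin

text \<open>Conformal flatness. Write the hypergeometric equation as \<open>w'' = P w' + Q w\<close>, let \<open>W\<close> be the Wronskian
of \<open>w\<^sub>1, w\<^sub>2\<close>, so that \<open>W' = P W\<close>, and put \<open>r = w\<^sub>2 / w\<^sub>1\<close>, \<open>f = w\<^sub>1\<^sup>2 W\<close>, \<open>B = w\<^sub>1 w\<^sub>1' / W\<close>, \<open>X = Q / W\<^sup>2\<close>.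
In terms of \<open>\<eta> = r dp - dz - K dx\<close> and \<open>\<zeta> = dp - I dx\<close> the metric becomes
\<open>g = - 2 f (dy - p dx) ds + h\<close> with
\<open>h = 2 w\<^sub>1\<^sup>4 \<eta> dx - 4/5 w\<^sub>1\<^sup>4 X \<eta>\<^sup>2 + 4/3 (\<zeta> + B \<eta>)\<^sup>2\<close>.
In coordinates the coefficients of \<open>h\<close> depend on \<open>s\<close> only and \<open>\<partial>\<^sub>y\<close> is a parallel null vector field: \<open>g\<close> is
a plane wave, with null coordinate \<open>u = I(s)\<close>. Let \<open>D = (1/f) d/ds\<close> be differentiation by \<open>u\<close> and let \<open>N\<close>
be the matrix by which \<open>\<nabla>\<close> in the direction \<open>u\<close> acts on \<open>\<partial>\<^sub>x, \<partial>\<^sub>z, \<partial>\<^sub>p\<close> modulo \<open>\<partial>\<^sub>y\<close>. The whole curvature is carried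
by the matrix \<open>D N + N\<^sup>2\<close>, and the Weyl tensor vanishes as soon as this matrix is a multiple of the
identity (\<open>weyl_eq_zeroI\<close>, \<open>riemann_eq\<close>).

The coframe \<open>dx, \<eta>, \<zeta>\<close> satisfies a closed linear system, so that \<open>N\<close> can be computed there without
knowing \<open>r, I, K\<close>. Eight of the nine entries of \<open>D N + N\<^sup>2 = \<mu>\<close> hold for every equation
\<open>w'' = P w' + Q w\<close>. In the ninth \<open>w\<^sub>1\<close> cancels, and it says
\<open>Q'' - 5 P Q' - 2 P' Q + 6 P\<^sup>2 Q = 8/5 Q\<^sup>2\<close>.
With \<open>u = s (1 - s)\<close>, \<open>n = (a + b + 1) s - c\<close> and \<open>t = 1 - 2 s\<close> this is the polynomial identity
\<open>(2 t + 3 n) (t + 2 n) = (8/5 a b + 2 (a + b)) u\<close>, which the three triples satisfy (\<open>hg_triple_condition\<close>).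

The 4-dimensional family. A solution on an interval is determined by its value and derivative at one
point, and these can be prescribed. A pair of solutions is therefore given by a \<open>2 \<times> 2\<close> matrix of initial
values, and it is linearly independent iff this matrix is invertible, which is an open condition in
\<open>\<real>\<^sup>4\<close>.

The classes. The squares of the exponent differences \<open>1 - c\<close>, \<open>c - a - b\<close>, \<open>a - b\<close> at \<open>0, 1, \<infinity>\<close> are only
permuted by a fractional linear substitution that permutes \<open>0, 1, \<infinity>\<close>, and they do not change when the
solutions are multiplied by powers of \<open>s\<close> and \<open>1 - s\<close>. Up to sign, the differences are
\<open>(1/2, 1/3, 2/3)\<close>, \<open>(1/3, 1/2, 2/3)\<close> and \<open>(1/3, 1/3, 4/3)\<close>. So the third triple is not related to the other
two, while \<open>s \<mapsto> 1 - s\<close> relates the first two. The proof of the negative part compares the coefficients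
of the two equations for each of the six substitutions (\<open>hg_related_equations\<close>).\<close>

section \<open>Coordinates and the Weyl tensor\<close>

lemma exhaust_5: "x = 1 \<or> x = 2 \<or> x = 3 \<or> x = 4 \<or> x = 5" for x :: 5
proof (induct x)
  case (of_int z)
  then have "z = 0 \<or> z = 1 \<or> z = 2 \<or> z = 3 \<or> z = 4" by fastforce
  then show ?case by auto
qed

lemma forall_5: "(\<forall>i::5. P i) \<longleftrightarrow> P 1 \<and> P 2 \<and> P 3 \<and> P 4 \<and> P 5"
  by (metis exhaust_5)

lemma UNIV_5: "UNIV = {1, 2, 3, 4, 5::5}"
  using exhaust_5 by auto

lemma sum_5: "sum f (UNIV::5 set) = f 1 + f 2 + f 3 + f 4 + f 5"
  unfolding UNIV_5 by (simp add: ac_simps)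

lemma partial_eqI:
  "((\<lambda>t. f (q + t *\<^sub>R axis i 1)) has_real_derivative D) (at 0) \<Longrightarrow> partial i f q = D"
  unfolding partial_def by (rule DERIV_imp_deriv)

text \<open>Moving along a coordinate line keeps the fifth coordinate in the open set \<open>J\<close> for a short time, so a
partial derivative sees a function only on the slab over \<open>J\<close>.\<close>

lemma partial_cong:
  fixes f f' :: "real^5 \<Rightarrow> real"
  assumes "open J" "q $ 5 \<in> J" "\<And>r. r $ 5 \<in> J \<Longrightarrow> f r = f' r"
  shows "partial i f q = partial i f' q"
proof -
  have "open ((\<lambda>t. (q + t *\<^sub>R axis i 1) $ 5) -` J)"
    by (intro open_vimage assms continuous_intros)
  then have "\<forall>\<^sub>F t in nhds 0. t \<in> (\<lambda>t. (q + t *\<^sub>R axis i 1) $ 5) -` J"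
    by (rule eventually_nhds_in_open) (use assms in auto)
  then have "\<forall>\<^sub>F t in nhds 0. f (q + t *\<^sub>R axis i 1) = f' (q + t *\<^sub>R axis i 1)"
    by eventually_elim (use assms(3) in auto)
  then show ?thesis
    unfolding partial_def by (rule deriv_cong_ev) auto
qed

text \<open>The metric and its Christoffel symbols are affine in \<open>p = r $ 4\<close> with coefficients depending on
\<open>s = r $ 5\<close>, so this and the next lemma give all partial derivatives that occur.\<close>

lemma partial_affine_other:
  fixes q :: "real^5"
  assumes "i \<noteq> 5"
  shows "partial i (\<lambda>r. \<phi> (r $ 5) + r $ 4 * \<psi> (r $ 5)) q = (if i = 4 then \<psi> (q $ 5) else 0)"
  using assms
  by (intro partial_eqI) (auto simp: axis_def intro!: derivative_eq_intros)

lemma partial_affine_5: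
  fixes q :: "real^5"
  assumes "(\<phi> has_real_derivative a) (at (q $ 5))" "(\<psi> has_real_derivative b) (at (q $ 5))"
  shows "partial 5 (\<lambda>r. \<phi> (r $ 5) + r $ 4 * \<psi> (r $ 5)) q = a + q $ 4 * b"
proof (rule partial_eqI)
  have "((\<lambda>t. \<phi> (q $ 5 + t)) has_real_derivative a) (at 0)"
    "((\<lambda>t. \<psi> (q $ 5 + t)) has_real_derivative b) (at 0)"
    using assms by (simp_all add: DERIV_at_within_shift_lemma add.commute
      flip: DERIV_shift)
  then show "((\<lambda>t. \<phi> ((q + t *\<^sub>R axis 5 1) $ 5) +
        (q + t *\<^sub>R axis 5 1) $ 4 * \<psi> ((q + t *\<^sub>R axis 5 1) $ 5)) has_real_derivative a + q $ 4 * b) (at 0)"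
    by (auto simp: axis_def intro!: derivative_eq_intros)
qed

lemma matrix_inv_left_mult: "invertible A \<Longrightarrow> matrix_inv A ** A = mat 1"
  for A :: "real^'n^'n"
  unfolding invertible_def matrix_inv_def by (metis (mono_tags, lifting) someI_ex)

text \<open>Christoffel symbols can be checked with lowered first index, without inverting the metric.\<close>

lemma christoffel_eqI:
  fixes g :: "'n::finite metric"
  assumes inv: "invertible (g q)"
    and low: "\<And>m. partial j (\<lambda>r. g r $ m $ k) q + partial k (\<lambda>r. g r $ m $ j) q
         - partial m (\<lambda>r. g r $ j $ k) q = 2 * (\<Sum>n\<in>UNIV. g q $ m $ n * G n)"
  shows "christoffel g i j k q = G i"
proof -
  have "christoffel g i j k q = (\<Sum>m\<in>UNIV. matrix_inv (g q) $ i $ m * (\<Sum>n\<in>UNIV. g q $ m $ n * G n))"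
    unfolding christoffel_def low by (simp add: sum_divide_distrib)
  also have "\<dots> = (matrix_inv (g q) *v (g q *v (\<chi> n. G n))) $ i"
    by (simp add: matrix_vector_mult_def)
  also have "\<dots> = G i"
    by (simp add: matrix_vector_mul_assoc matrix_inv_left_mult inv)
  finally show ?thesis .
qed

text \<open>The assumption says that the lowered curvature is the Kulkarni-Nomizu product of \<open>g\<close> with \<open>e \<otimes> e\<close>,
up to a factor. Such a tensor has no Weyl part. Since \<open>e\<close> is null, the Ricci tensor is again a multiple of
\<open>e \<otimes> e\<close> and the scalar curvature vanishes.\<close>

lemma weyl_eq_zeroI:
  fixes g :: "'n::finite metric" and e n :: "real^'n"
  assumes card: "CARD('n) \<ge> 3" and inv: "invertible (g q)"
    and dual: "g q *v n = e" and null: "(\<Sum>i\<in>UNIV. e $ i * n $ i) = 0"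
    and R: "\<And>i j k l. riemann g i j k l q = \<mu> * ((if i = k then e $ j * e $ l else 0)
        - (if i = l then e $ j * e $ k else 0) - g q $ j $ k * n $ i * e $ l + g q $ j $ l * n $ i * e $ k)"
  shows "weyl g i j k l q = 0"
proof -
  have gn: "(\<Sum>m\<in>UNIV. g q $ i $ m * n $ m) = e $ i" for i
    using dual by (auto simp: matrix_vector_mult_def)
  have low: "riemann_low g i j k l q = \<mu> * (g q $ i $ k * e $ j * e $ l - g q $ i $ l * e $ j * e $ k
      - g q $ j $ k * e $ i * e $ l + g q $ j $ l * e $ i * e $ k)" for i j k l
  proof -
    have "riemann_low g i j k l q = (\<Sum>m\<in>UNIV. \<mu> * ((if m = k then g q $ i $ k * e $ j * e $ l else 0)
        - (if m = l then g q $ i $ l * e $ j * e $ k else 0)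
        - g q $ j $ k * e $ l * (g q $ i $ m * n $ m) + g q $ j $ l * e $ k * (g q $ i $ m * n $ m)))"
      unfolding riemann_low_def R by (intro sum.cong) (auto simp: algebra_simps)
    also have "\<dots> = \<mu> * (g q $ i $ k * e $ j * e $ l - g q $ i $ l * e $ j * e $ k
      - g q $ j $ k * e $ i * e $ l + g q $ j $ l * e $ i * e $ k)"
      by (simp add: sum.distrib sum_subtractf gn flip: sum_distrib_left)
    finally show ?thesis .
  qed
  have ric: "ricci g j l q = \<mu> * (real CARD('n) - 2) * e $ j * e $ l" for j l
  proof -
    have "ricci g j l q = (\<Sum>m\<in>UNIV. \<mu> * (e $ j * e $ l - (if m = l then e $ j * e $ l else 0)
        - e $ l * (g q $ j $ m * n $ m) + g q $ j $ l * (e $ m * n $ m)))"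
      unfolding ricci_def R by (intro sum.cong) (auto simp: algebra_simps)
    also have "\<dots> = \<mu> * (real CARD('n) - 2) * e $ j * e $ l"
      by (simp add: sum.distrib sum_subtractf gn null right_diff_distrib flip: sum_distrib_left)
        (simp add: algebra_simps)
    finally show ?thesis .
  qed
  have ginv: "(\<Sum>l\<in>UNIV. matrix_inv (g q) $ j $ l * e $ l) = n $ j" for j
  proof -
    have "matrix_inv (g q) *v e = n"
      using inv by (simp add: matrix_vector_mul_assoc matrix_inv_left_mult flip: dual)
    then show ?thesis by (auto simp: matrix_vector_mult_def)
  qed
  have "scalar_curv g q = (\<Sum>j\<in>UNIV. \<mu> * (real CARD('n) - 2) * (e $ j * (\<Sum>l\<in>UNIV. matrix_inv (g q) $ j $ l * e $ l)))"
    unfolding scalar_curv_def ric by (simp add: sum_distrib_left algebra_simps)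
  then have scal: "scalar_curv g q = 0"
    by (simp add: ginv null flip: sum_distrib_left)
  have "real CARD('n) - 2 \<noteq> 0" using card by linarith
  then show ?thesis
    unfolding weyl_def Let_def low ric scal by (simp add: field_simps)
qed

section \<open>Curvature of a plane wave\<close>

text \<open>The metric \<open>h - 2 f (dy - p dx) ds\<close>, where \<open>h\<close> lives on the coordinates \<open>x, z, p\<close> (indices 1, 3, 4) and
depends on \<open>s\<close> only. \<open>Dh\<close> and \<open>DN\<close> are the derivatives of \<open>h\<close> and \<open>N\<close> by a function \<open>u\<close> with \<open>du = f ds\<close>. The
matrix \<open>f N\<close> is the block \<open>\<Gamma>\<^sup>i\<^sub>j\<^sub>s\<close>; lowering the index of \<open>N\<close> gives half of \<open>\<partial>\<^sub>u h\<close> plus half of the 2-form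
\<open>d(p dx)\<close>, which is where the entries \<open>\<plusminus> 1\<close> come from.\<close>

locale plane_wave =
  fixes J :: "real set" and f f' \<mu> :: "real \<Rightarrow> real"
    and h Dh N DN :: "5 \<Rightarrow> 5 \<Rightarrow> real \<Rightarrow> real" and g :: "5 metric"
  assumes J: "open J"
    and f_deriv: "\<And>s. s \<in> J \<Longrightarrow> (f has_real_derivative f' s) (at s)"
    and f_nz: "\<And>s. s \<in> J \<Longrightarrow> f s \<noteq> 0"
    and h_deriv: "\<And>i j s. s \<in> J \<Longrightarrow> (h i j has_real_derivative f s * Dh i j s) (at s)"
    and N_deriv: "\<And>i j s. s \<in> J \<Longrightarrow> (N i j has_real_derivative f s * DN i j s) (at s)"
    and h_sym: "\<And>i j. h i j = h j i"
    and h_zero: "\<And>i s. h 2 i s = 0" "\<And>i s. h 5 i s = 0"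
    and N_zero: "\<And>i s. N 2 i s = 0" "\<And>i s. N 5 i s = 0" "\<And>i s. N i 2 s = 0" "\<And>i s. N i 5 s = 0"
    and h_nondeg: "\<And>s x. s \<in> J \<Longrightarrow> (\<And>i. (\<Sum>j\<in>UNIV. h i j s * x j) = 0) \<Longrightarrow> x 1 = 0 \<and> x 3 = 0 \<and> x 4 = 0"
    and lower: "\<And>i j s. s \<in> J \<Longrightarrow> (\<Sum>m\<in>UNIV. h i m s * N m j s) =
        (Dh i j s + (if i = 1 \<and> j = 4 then 1 else if i = 4 \<and> j = 1 then -1 else 0)) / 2"
    and riccati: "\<And>i j s. s \<in> J \<Longrightarrow> DN i j s + (\<Sum>m\<in>UNIV. N i m s * N m j s) =
        (if i = j \<and> i \<noteq> 2 \<and> i \<noteq> 5 then \<mu> s else 0)"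
    and metric: "\<And>q i j. q $ 5 \<in> J \<Longrightarrow> g q $ i $ j = h i j (q $ 5)
        + (if i = 2 \<and> j = 5 \<or> i = 5 \<and> j = 2 then - f (q $ 5) else 0)
        + q $ 4 * (if i = 1 \<and> j = 5 \<or> i = 5 \<and> j = 1 then f (q $ 5) else 0)"
begin

lemma h_zero': "h i 2 s = 0" "h i 5 s = 0"
  using h_zero h_sym by metis+

lemma Dh_zero:
  assumes "s \<in> J"
  shows "Dh 2 i s = 0" "Dh 5 i s = 0" "Dh i 2 s = 0" "Dh i 5 s = 0"
  using lower[of s 2 i] lower[of s 5 i] lower[of s i 2] lower[of s i 5] assms
  by (auto simp: h_zero N_zero)

lemma Dh_sym: "s \<in> J \<Longrightarrow> Dh i j s = Dh j i s"
  using DERIV_unique[OF h_deriv[of s i j] h_deriv[of s j i, unfolded h_sym[of j i]]] f_nz[of s] by simp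

lemma transpose_g: "q $ 5 \<in> J \<Longrightarrow> transpose (g q) = g q"
  unfolding transpose_def vec_eq_iff by (auto simp: metric h_sym)

text \<open>A vector in the kernel has no \<open>s\<close>-component by row \<open>y\<close>, then no \<open>x, z, p\<close>-components because \<open>h\<close> is
nondegenerate, and then no \<open>y\<close>-component by row \<open>s\<close>.\<close>

lemma invertible_g:
  assumes q: "q $ 5 \<in> J"
  shows "invertible (g q)"
proof -
  have "x = 0" if "g q *v x = 0" for x
  proof -
    have *: "(\<Sum>j\<in>UNIV. g q $ i $ j * x $ j) = 0" for i
      using that by (auto simp: matrix_vector_mult_def vec_eq_iff)
    from *[of 2] have x5: "x $ 5 = 0"
      using f_nz[OF q] by (simp add: metric[OF q] sum_5 h_zero)
    have "(\<Sum>j\<in>UNIV. h i j (q $ 5) * x $ j) = 0" for i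
    proof (cases "i = 5")
      case False
      with *[of i] x5 show ?thesis by (simp add: metric[OF q] sum_5 h_zero')
    qed (simp add: h_zero)
    from h_nondeg[OF q this] have x134: "x $ 1 = 0" "x $ 3 = 0" "x $ 4 = 0" by auto
    from *[of 5] x134 x5 have "x $ 2 = 0"
      using f_nz[OF q] by (simp add: metric[OF q] sum_5 h_zero)
    with x5 x134 show ?thesis by (simp add: vec_eq_iff forall_5)
  qed
  then show ?thesis
    unfolding invertible_left_inverse matrix_left_invertible_ker by blast
qed

lemma partial_g:
  assumes q: "q $ 5 \<in> J"
  shows "partial k (\<lambda>r. g r $ i $ j) q =
    (if k = 5 then f (q $ 5) * Dh i j (q $ 5)
        + (if i = 2 \<and> j = 5 \<or> i = 5 \<and> j = 2 then - f' (q $ 5) else 0)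
        + q $ 4 * (if i = 1 \<and> j = 5 \<or> i = 5 \<and> j = 1 then f' (q $ 5) else 0)
     else if k = 4 \<and> (i = 1 \<and> j = 5 \<or> i = 5 \<and> j = 1) then f (q $ 5) else 0)"
proof -
  let ?\<phi> = "\<lambda>s. h i j s + (if i = 2 \<and> j = 5 \<or> i = 5 \<and> j = 2 then - f s else 0)"
  let ?\<psi> = "\<lambda>s. if i = 1 \<and> j = 5 \<or> i = 5 \<and> j = 1 then f s else 0"
  have eq: "partial k (\<lambda>r. g r $ i $ j) q = partial k (\<lambda>r. ?\<phi> (r $ 5) + r $ 4 * ?\<psi> (r $ 5)) q"
    by (rule partial_cong[OF J q]) (rule metric)
  show ?thesis
  proof (cases "k = 5")
    case True
    have "(?\<phi> has_real_derivative f (q $ 5) * Dh i j (q $ 5)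
        + (if i = 2 \<and> j = 5 \<or> i = 5 \<and> j = 2 then - f' (q $ 5) else 0)) (at (q $ 5))"
      using h_deriv[OF q, of i j] f_deriv[OF q]
      by (cases "i = 2 \<and> j = 5 \<or> i = 5 \<and> j = 2") (auto intro!: derivative_eq_intros)
    moreover have "(?\<psi> has_real_derivative
        (if i = 1 \<and> j = 5 \<or> i = 5 \<and> j = 1 then f' (q $ 5) else 0)) (at (q $ 5))"
      using f_deriv[OF q] by (cases "i = 1 \<and> j = 5 \<or> i = 5 \<and> j = 1") auto
    ultimately show ?thesis
      unfolding eq using partial_affine_5[of ?\<phi> _ q ?\<psi>] True by simp
  next
    case False
    then show ?thesis
      unfolding eq partial_affine_other[of k ?\<phi> ?\<psi> q, OF False] by simp
  qed
qed

definition lowered :: "5 \<Rightarrow> 5 \<Rightarrow> real \<Rightarrow> real" where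
  "lowered i j s = (\<Sum>m\<in>UNIV. h i m s * N m j s)"

lemma lowered_zero: "lowered 2 i s = 0" "lowered 5 i s = 0" "lowered i 2 s = 0" "lowered i 5 s = 0"
  by (simp_all add: lowered_def h_zero N_zero)

text \<open>The symmetric part of \<open>h N\<close> comes from \<open>h\<close>, the antisymmetric part from \<open>d(p dx)\<close>.\<close>

lemma lowered_flip:
  assumes "s \<in> J"
  shows "lowered j i s = lowered i j s - (if i = 1 \<and> j = 4 then 1 else if i = 4 \<and> j = 1 then -1 else 0)"
  using lower[OF assms, of i j] lower[OF assms, of j i] Dh_sym[OF assms, of i j]
  unfolding lowered_def by (auto split: if_splits)

lemma Dh_lowered:
  "s \<in> J \<Longrightarrow> Dh i j s = 2 * lowered i j s - (if i = 1 \<and> j = 4 then 1 else if i = 4 \<and> j = 1 then -1 else 0)"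
  using lower[of s i j] unfolding lowered_def by simp

text \<open>By the Riccati equation the derivative of \<open>h N\<close> by \<open>u\<close> is \<open>\<mu> h + N\<^sup>T h N\<close>.\<close>

lemma lowered_deriv:
  assumes s: "s \<in> J"
  shows "(lowered i j has_real_derivative f s * (\<mu> s * h i j s + (\<Sum>m\<in>UNIV. lowered m i s * N m j s))) (at s)"
proof -
  let ?F = "\<lambda>a b. (if a = 1 \<and> b = 4 then 1 else if a = 4 \<and> b = 1 then -1 else 0) :: real"
  have "(lowered i j has_real_derivative
      (\<Sum>m\<in>UNIV. f s * Dh i m s * N m j s + h i m s * (f s * DN m j s))) (at s)"
    unfolding lowered_def[abs_def] by (rule DERIV_sum) (auto intro!: derivative_eq_intros h_deriv N_deriv s)
  also have "(\<Sum>m\<in>UNIV. f s * Dh i m s * N m j s + h i m s * (f s * DN m j s)) =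
      f s * (\<Sum>m\<in>UNIV. Dh i m s * N m j s) + f s * (\<Sum>m\<in>UNIV. h i m s * DN m j s)"
    by (simp add: sum_distrib_left sum.distrib algebra_simps)
  also have "(\<Sum>m\<in>UNIV. h i m s * DN m j s) =
      (\<Sum>m\<in>UNIV. h i m s * (if m = j \<and> m \<noteq> 2 \<and> m \<noteq> 5 then \<mu> s else 0))
        - (\<Sum>m\<in>UNIV. \<Sum>n\<in>UNIV. h i m s * (N m n s * N n j s))"
    unfolding riccati[OF s, symmetric] by (simp add: sum_distrib_left sum_subtractf algebra_simps sum.distrib)
  also have "(\<Sum>m\<in>UNIV. h i m s * (if m = j \<and> m \<noteq> 2 \<and> m \<noteq> 5 then \<mu> s else 0)) = \<mu> s * h i j s"
    using exhaust_5[of j] by (auto simp: sum_5 h_zero')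
  also have "(\<Sum>m\<in>UNIV. \<Sum>n\<in>UNIV. h i m s * (N m n s * N n j s)) = (\<Sum>n\<in>UNIV. lowered i n s * N n j s)"
    unfolding lowered_def by (subst sum.swap) (simp add: sum_distrib_right mult.assoc)
  also have "(\<Sum>m\<in>UNIV. Dh i m s * N m j s) = (\<Sum>m\<in>UNIV. (2 * lowered i m s - ?F i m) * N m j s)"
    unfolding Dh_lowered[OF s] ..
  also have "\<dots> = (\<Sum>m\<in>UNIV. lowered m i s * N m j s) + (\<Sum>n\<in>UNIV. lowered i n s * N n j s)"
    unfolding sum.distrib[symmetric]
    by (intro sum.cong) (simp_all add: lowered_flip[OF s, where i = i] algebra_simps)
  finally show ?thesis by (simp add: algebra_simps)
qed

text \<open>The parts of the Christoffel symbols \<open>\<Gamma>\<^sup>i\<^sub>j\<^sub>k\<close> that are constant and linear in \<open>p\<close>.\<close>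

definition conn_static :: "5 \<Rightarrow> 5 \<Rightarrow> 5 \<Rightarrow> real \<Rightarrow> real" where
  "conn_static i j k s = (if k = 5 then f s * N i j s else 0) + (if j = 5 then f s * N i k s else 0)
     + (if i = 5 \<and> j = 5 \<and> k = 5 then f' s / f s else 0)
     + (if i = 2 then lowered j k s - (if j = 1 \<and> k = 4 then 1 else 0) else 0)"

definition conn_linear :: "5 \<Rightarrow> 5 \<Rightarrow> 5 \<Rightarrow> real \<Rightarrow> real" where
  "conn_linear i j k s = (if i = 2 then (if k = 5 then f s * N 1 j s else 0)
     + (if j = 5 then f s * N 1 k s else 0) else 0)"

lemma christoffel_eq:
  assumes q: "q $ 5 \<in> J"
  shows "christoffel g i j k q = conn_static i j k (q $ 5) + q $ 4 * conn_linear i j k (q $ 5)"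
proof (rule christoffel_eqI)
  show "invertible (g q)" by (rule invertible_g[OF q])
next
  fix m
  let ?s = "q $ 5"
  have gN: "(\<Sum>n\<in>UNIV. g q $ m $ n * N n b ?s) = lowered m b ?s + q $ 4 * (if m = 5 then f ?s * N 1 b ?s else 0)" for b
    unfolding lowered_def metric[OF q] by (simp add: sum_5 N_zero algebra_simps)
  have "(\<Sum>n\<in>UNIV. g q $ m $ n * (conn_static n j k ?s + q $ 4 * conn_linear n j k ?s)) =
      (\<Sum>n\<in>UNIV. (if k = 5 then f ?s else 0) * (g q $ m $ n * N n j ?s) + (if j = 5 then f ?s else 0) * (g q $ m $ n * N n k ?s))
      + g q $ m $ 5 * (if j = 5 \<and> k = 5 then f' ?s / f ?s else 0)
      + g q $ m $ 2 * (lowered j k ?s - (if j = 1 \<and> k = 4 then 1 else 0)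
          + q $ 4 * ((if k = 5 then f ?s * N 1 j ?s else 0) + (if j = 5 then f ?s * N 1 k ?s else 0)))"
    unfolding sum_5 conn_static_def conn_linear_def by (simp add: algebra_simps)
  also have "\<dots> = (if k = 5 then f ?s * lowered m j ?s else 0) + (if j = 5 then f ?s * lowered m k ?s else 0)
      + (if j = 5 \<and> k = 5 then g q $ m $ 5 * f' ?s / f ?s else 0)
      - (if m = 5 then f ?s * (lowered j k ?s - (if j = 1 \<and> k = 4 then 1 else 0)) else 0)"
    unfolding sum.distrib sum_distrib_left[symmetric] gN metric[OF q, of m 2]
    by (simp add: h_zero' algebra_simps)
  finally have low: "(\<Sum>n\<in>UNIV. g q $ m $ n * (conn_static n j k ?s + q $ 4 * conn_linear n j k ?s)) = \<dots>" .
  have "\<forall>m j k. partial j (\<lambda>r. g r $ m $ k) q + partial k (\<lambda>r. g r $ m $ j) q - partial m (\<lambda>r. g r $ j $ k) q =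
      2 * ((if k = 5 then f ?s * lowered m j ?s else 0) + (if j = 5 then f ?s * lowered m k ?s else 0)
      + (if j = 5 \<and> k = 5 then g q $ m $ 5 * f' ?s / f ?s else 0)
      - (if m = 5 then f ?s * (lowered j k ?s - (if j = 1 \<and> k = 4 then 1 else 0)) else 0))"
    unfolding forall_5 partial_g[OF q] metric[OF q] Dh_lowered[OF q]
    using f_nz[OF q] lowered_flip[OF q, of 3 1] lowered_flip[OF q, of 4 1] lowered_flip[OF q, of 4 3]
    by (simp add: lowered_zero h_zero h_zero' algebra_simps)
  then show "partial j (\<lambda>r. g r $ m $ k) q + partial k (\<lambda>r. g r $ m $ j) q - partial m (\<lambda>r. g r $ j $ k) q =
       2 * (\<Sum>n\<in>UNIV. g q $ m $ n * (conn_static n j k ?s + q $ 4 * conn_linear n j k ?s))"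
    unfolding low by blast
qed

lemma partial_christoffel_other:
  assumes q: "q $ 5 \<in> J" and "k \<noteq> 5"
  shows "partial k (christoffel g i l j) q = (if k = 4 then conn_linear i l j (q $ 5) else 0)"
proof -
  have "partial k (christoffel g i l j) q =
      partial k (\<lambda>r. conn_static i l j (r $ 5) + r $ 4 * conn_linear i l j (r $ 5)) q"
    by (rule partial_cong[OF J q christoffel_eq])
  then show ?thesis
    using partial_affine_other[OF assms(2), of "conn_static i l j" "conn_linear i l j" q] by simp
qed

lemma partial_christoffel_5:
  assumes q: "q $ 5 \<in> J" and "l \<noteq> 5"
  shows "partial 5 (christoffel g i l j) q =
    (if j = 5 then f' (q $ 5) * N i l (q $ 5) + (f (q $ 5))\<^sup>2 * DN i l (q $ 5) else 0)
    + (if i = 2 then f (q $ 5) * (\<mu> (q $ 5) * h l j (q $ 5) + (\<Sum>m\<in>UNIV. lowered m l (q $ 5) * N m j (q $ 5))) else 0)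
    + q $ 4 * (if i = 2 \<and> j = 5 then f' (q $ 5) * N 1 l (q $ 5) + (f (q $ 5))\<^sup>2 * DN 1 l (q $ 5) else 0)"
proof -
  let ?s = "q $ 5"
  have fN: "((\<lambda>s. f s * N a b s) has_real_derivative f' ?s * N a b ?s + (f ?s)\<^sup>2 * DN a b ?s) (at ?s)" for a b
    using f_deriv[OF q] N_deriv[OF q, of a b]
    by (auto intro!: derivative_eq_intros simp: power2_eq_square algebra_simps)
  have "(conn_static i l j has_real_derivative
      (if j = 5 then f' ?s * N i l ?s + (f ?s)\<^sup>2 * DN i l ?s else 0)
      + (if i = 2 then f ?s * (\<mu> ?s * h l j ?s + (\<Sum>m\<in>UNIV. lowered m l ?s * N m j ?s)) else 0)) (at ?s)"
  proof -
    have "((\<lambda>s. if j = 5 then f s * N i l s else 0) has_real_derivative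
        (if j = 5 then f' ?s * N i l ?s + (f ?s)\<^sup>2 * DN i l ?s else 0)) (at ?s)"
      using fN by simp
    moreover have "((\<lambda>s. if i = 2 then lowered l j s - (if l = 1 \<and> j = 4 then 1 else 0) else 0) has_real_derivative
        (if i = 2 then f ?s * (\<mu> ?s * h l j ?s + (\<Sum>m\<in>UNIV. lowered m l ?s * N m j ?s)) else 0)) (at ?s)"
      using DERIV_diff[OF lowered_deriv[OF q, of l j] DERIV_const] by simp
    ultimately show ?thesis
      unfolding conn_static_def[abs_def] using assms(2) DERIV_add by fastforce
  qed
  moreover have "(conn_linear i l j has_real_derivative
      (if i = 2 \<and> j = 5 then f' ?s * N 1 l ?s + (f ?s)\<^sup>2 * DN 1 l ?s else 0)) (at ?s)"
    unfolding conn_linear_def[abs_def] using assms(2) fN[of 1 l] by (cases "i = 2") auto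
  moreover have eq: "partial 5 (christoffel g i l j) q =
      partial 5 (\<lambda>r. conn_static i l j (r $ 5) + r $ 4 * conn_linear i l j (r $ 5)) q"
    by (rule partial_cong[OF J q christoffel_eq])
  ultimately show ?thesis
    using partial_affine_5[of "conn_static i l j" _ q "conn_linear i l j"] eq by simp
qed

text \<open>The derivatives \<open>DN\<close> enter together with \<open>N\<^sup>2\<close>, so the Riccati equation leaves \<open>\<mu>\<close> times the identity.\<close>

lemma riemann_ds:
  assumes q: "q $ 5 \<in> J" and k: "k \<noteq> 5"
  shows "riemann g i j k 5 q = - (f (q $ 5))\<^sup>2 * \<mu> (q $ 5) *
      ((if i = k \<and> j = 5 then 1 else 0) + (if i = 2 then g q $ j $ k / f (q $ 5) else 0))"
proof -
  let ?s = "q $ 5"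
  have chr: "christoffel g i j k q = conn_static i j k ?s + q $ 4 * conn_linear i j k ?s" for i j k
    by (rule christoffel_eq[OF q])
  have dn: "DN i j ?s = (if i = j \<and> i \<noteq> 2 \<and> i \<noteq> 5 then \<mu> ?s else 0) - (\<Sum>m\<in>UNIV. N i m ?s * N m j ?s)" for i j
    using riccati[OF q, of i j] by simp
  have flip: "lowered 3 1 ?s = lowered 1 3 ?s" "lowered 4 1 ?s = lowered 1 4 ?s - 1" "lowered 4 3 ?s = lowered 3 4 ?s"
    using lowered_flip[OF q, of 3 1] lowered_flip[OF q, of 4 1] lowered_flip[OF q, of 4 3] by simp_all
  have sym: "h 3 1 = h 1 3" "h 4 1 = h 1 4" "h 4 3 = h 3 4"
    by (auto intro: h_sym)
  have "\<forall>i j k. k \<noteq> 5 \<longrightarrow> riemann g i j k 5 q = - (f (q $ 5))\<^sup>2 * \<mu> (q $ 5) *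
      ((if i = k \<and> j = 5 then 1 else 0) + (if i = 2 then g q $ j $ k / f (q $ 5) else 0))"
    unfolding forall_5
    apply (intro conjI impI)
    apply (simp_all add: riemann_def chr partial_christoffel_other[OF q] partial_christoffel_5[OF q]
      metric[OF q] sum_5 conn_static_def conn_linear_def h_zero h_zero' N_zero lowered_zero dn flip sym)
    using f_nz[OF q]
    apply (simp_all add: field_simps power2_eq_square)
    done
  then show ?thesis using k by blast
qed

text \<open>Both sides are the entries of \<open>N\<^sup>T h N\<close>.\<close>

lemma lowered_N_sym: "(\<Sum>m\<in>UNIV. lowered m i s * N m j s) = (\<Sum>m\<in>UNIV. lowered m j s * N m i s)"
proof -
  have "(\<Sum>m\<in>UNIV. lowered m i s * N m j s) = (\<Sum>m\<in>UNIV. \<Sum>n\<in>UNIV. h m n s * N n i s * N m j s)"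
    unfolding lowered_def by (simp add: sum_distrib_right)
  also have "\<dots> = (\<Sum>n\<in>UNIV. \<Sum>m\<in>UNIV. h n m s * N m j s * N n i s)"
    by (subst sum.swap) (simp add: h_sym mult_ac)
  also have "\<dots> = (\<Sum>m\<in>UNIV. lowered m j s * N m i s)"
    unfolding lowered_def by (simp add: sum_distrib_right)
  finally show ?thesis .
qed

text \<open>Only \<open>R\<^sup>y\<^sub>s\<^sub>k\<^sub>l\<close> needs an argument: the products of Christoffel symbols contribute to it the
antisymmetric part of \<open>N\<^sup>T h N\<close>, which vanishes, and terms that cancel the derivatives by \<open>p\<close>.\<close>

lemma riemann_no_ds:
  assumes q: "q $ 5 \<in> J" and k: "k \<noteq> 5" and l: "l \<noteq> 5"
  shows "riemann g i j k l q = 0"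
proof -
  let ?s = "q $ 5"
  have chr: "christoffel g i j k q = conn_static i j k ?s + q $ 4 * conn_linear i j k ?s" for i j k
    by (rule christoffel_eq[OF q])
  show ?thesis
  proof (cases "j = 5")
    case True
    have "christoffel g i k m q * christoffel g m l 5 q =
        (if i = 2 then f ?s * (lowered m k ?s * N m l ?s - (if k = 4 \<and> m = 1 then N m l ?s else 0)) else 0)"
      if "k \<noteq> 5" "l \<noteq> 5" for k l m
      using that
      by (cases "m = 5"; cases "m = 2")
        (auto simp: lowered_flip[OF q, where j = k and i = m] chr conn_static_def conn_linear_def N_zero lowered_zero algebra_simps split: if_splits)
    then have prod: "(\<Sum>m\<in>UNIV. christoffel g i k m q * christoffel g m l 5 q) =
        (if i = 2 then f ?s * ((\<Sum>m\<in>UNIV. lowered m k ?s * N m l ?s) - (if k = 4 then N 1 l ?s else 0)) else 0)"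
      if "k \<noteq> 5" "l \<noteq> 5" for k l
      using that by (simp add: sum_5 algebra_simps)
    show ?thesis
      using k l lowered_N_sym[of k ?s l]
      by (simp add: True riemann_def sum_subtractf prod partial_christoffel_other[OF q] conn_linear_def algebra_simps)
  next
    case False
    then show ?thesis using k l
      by (simp add: riemann_def chr partial_christoffel_other[OF q] sum_5
          conn_static_def conn_linear_def lowered_zero)
  qed
qed

text \<open>Here \<open>e = ds\<close>, and \<open>n\<close> is the multiple of \<open>\<partial>\<^sub>y\<close> that is dual to it.\<close>

lemma riemann_eq:
  assumes q: "q $ 5 \<in> J"
  defines "e \<equiv> axis 5 1 :: real^5" and "n \<equiv> - (1 / f (q $ 5)) *\<^sub>R axis 2 1 :: real^5"
  shows "riemann g i j k l q = - (f (q $ 5))\<^sup>2 * \<mu> (q $ 5) * ((if i = k then e $ j * e $ l else 0)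
        - (if i = l then e $ j * e $ k else 0) - g q $ j $ k * n $ i * e $ l + g q $ j $ l * n $ i * e $ k)"
proof -
  have flip: "riemann g i j k l q = - riemann g i j l k q" for k l
    unfolding riemann_def by (simp add: sum_subtractf)
  consider "k \<noteq> 5" "l \<noteq> 5" | "k \<noteq> 5" "l = 5" | "k = 5" "l \<noteq> 5" | "k = 5" "l = 5" by blast
  then show ?thesis
  proof cases
    case 1
    then show ?thesis using riemann_no_ds[OF q] by (simp add: e_def axis_def)
  next
    case 2
    then show ?thesis using riemann_ds[OF q, of k i j] by (simp add: e_def n_def axis_def)
  next
    case 3
    then show ?thesis using riemann_ds[OF q, of l i j] flip[of k l]
      by (simp add: e_def n_def axis_def) (simp add: algebra_simps)
  next
    case 4
    then show ?thesis using flip[of k l] by simp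
  qed
qed

theorem pseudo_metric: "pseudo_metric_on {q. q $ 5 \<in> J} g"
  unfolding pseudo_metric_on_def using transpose_g invertible_g by blast

theorem conformally_flat: "conformally_flat_on {q. q $ 5 \<in> J} g"
  unfolding conformally_flat_on_def
proof (clarify)
  fix q :: "real^5" and i j k l
  assume q: "q $ 5 \<in> J"
  show "weyl g i j k l q = 0"
  proof (rule weyl_eq_zeroI[OF _ invertible_g[OF q] _ _ riemann_eq[OF q]])
    show "g q *v (- (1 / f (q $ 5)) *\<^sub>R axis 2 1) = axis 5 1"
      using f_nz[OF q] by (simp add: vec_eq_iff matrix_vector_mult_def metric[OF q] sum_5 axis_def h_zero')
  qed (simp_all add: axis_def sum_5)
qed

end

section \<open>The frame adapted to the coframe of the metric\<close>

text \<open>The functions attached to a pair of solutions, with \<open>\<rho> = w\<^sub>1\<^sup>-\<^sup>4\<close> and \<open>Y\<close> the derivative of \<open>X\<close> by \<open>u\<close>.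
The equation for \<open>Y\<close> is the condition for conformal flatness; the other ones hold for all second-order
linear equations.\<close>

locale frame_system =
  fixes J :: "real set" and f f' \<rho> B X Y r I K :: "real \<Rightarrow> real"
  assumes J: "open J"
    and f_deriv: "\<And>s. s \<in> J \<Longrightarrow> (f has_real_derivative f' s) (at s)"
    and f_nz: "\<And>s. s \<in> J \<Longrightarrow> f s \<noteq> 0"
    and \<rho>_nz: "\<And>s. s \<in> J \<Longrightarrow> \<rho> s \<noteq> 0"
    and \<rho>_deriv: "\<And>s. s \<in> J \<Longrightarrow> (\<rho> has_real_derivative f s * (- 4 * B s * (\<rho> s)\<^sup>2)) (at s)"
    and B_deriv: "\<And>s. s \<in> J \<Longrightarrow> (B has_real_derivative f s * ((B s)\<^sup>2 * \<rho> s + X s)) (at s)"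
    and X_deriv: "\<And>s. s \<in> J \<Longrightarrow> (X has_real_derivative f s * Y s) (at s)"
    and Y_deriv: "\<And>s. s \<in> J \<Longrightarrow>
        (Y has_real_derivative f s * (8/5 * \<rho> s * (X s)\<^sup>2 - 2 * B s * \<rho> s * Y s)) (at s)"
    and r_deriv: "\<And>s. s \<in> J \<Longrightarrow> (r has_real_derivative f s * \<rho> s) (at s)"
    and I_deriv: "\<And>s. s \<in> J \<Longrightarrow> (I has_real_derivative f s) (at s)"
    and K_deriv: "\<And>s. s \<in> J \<Longrightarrow> (K has_real_derivative f s * (I s * \<rho> s)) (at s)"
begin

text \<open>The coefficients of the 1-forms \<open>dx\<close>, \<open>\<eta> = r dp - dz - K dx\<close>, \<open>\<zeta> = dp - I dx\<close>, and below the frame of the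
\<open>x, z, p\<close>-space dual to them.\<close>

definition form_x :: "5 \<Rightarrow> real \<Rightarrow> real" where
  "form_x i s = (if i = 1 then 1 else 0)"
definition form_eta :: "5 \<Rightarrow> real \<Rightarrow> real" where
  "form_eta i s = (if i = 1 then - K s else if i = 3 then - 1 else if i = 4 then r s else 0)"
definition form_zeta :: "5 \<Rightarrow> real \<Rightarrow> real" where
  "form_zeta i s = (if i = 1 then - I s else if i = 4 then 1 else 0)"

definition vec_x :: "5 \<Rightarrow> real \<Rightarrow> real" where
  "vec_x i s = (if i = 1 then 1 else if i = 3 then r s * I s - K s else if i = 4 then I s else 0)"
definition vec_eta :: "5 \<Rightarrow> real \<Rightarrow> real" where
  "vec_eta i s = (if i = 3 then - 1 else 0)"
definition vec_zeta :: "5 \<Rightarrow> real \<Rightarrow> real" where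
  "vec_zeta i s = (if i = 3 then r s else if i = 4 then 1 else 0)"

lemma coframe_deriv:
  assumes "s \<in> J"
  shows "(form_x i has_real_derivative 0) (at s)"
    "(form_eta i has_real_derivative f s * (\<rho> s * form_zeta i s)) (at s)"
    "(form_zeta i has_real_derivative f s * (- form_x i s)) (at s)"
  unfolding form_x_def[abs_def] form_eta_def[abs_def] form_zeta_def[abs_def]
  using r_deriv[OF assms] I_deriv[OF assms] K_deriv[OF assms] exhaust_5[of i]
  by (auto intro!: derivative_eq_intros)

lemma frame_deriv:
  assumes "s \<in> J"
  shows "(vec_x i has_real_derivative f s * vec_zeta i s) (at s)"
    "(vec_eta i has_real_derivative 0) (at s)"
    "(vec_zeta i has_real_derivative f s * (- \<rho> s * vec_eta i s)) (at s)"
  unfolding vec_x_def[abs_def] vec_eta_def[abs_def] vec_zeta_def[abs_def]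
  using r_deriv[OF assms] I_deriv[OF assms] K_deriv[OF assms] exhaust_5[of i]
  by (auto intro!: derivative_eq_intros simp: algebra_simps)

lemma frame_complete:
  "vec_x i s * form_x j s + vec_eta i s * form_eta j s + vec_zeta i s * form_zeta j s = (if i = j \<and> i \<noteq> 2 \<and> i \<noteq> 5 then 1 else 0)"
proof -
  have "\<forall>i j. vec_x i s * form_x j s + vec_eta i s * form_eta j s + vec_zeta i s * form_zeta j s = (if i = j \<and> i \<noteq> 2 \<and> i \<noteq> 5 then 1 else 0)"
    unfolding forall_5 by (simp add: form_x_def form_eta_def form_zeta_def vec_x_def vec_eta_def vec_zeta_def)
  then show ?thesis by blast
qed

text \<open>The 2-form \<open>d(p dx)\<close> in the coframe: \<open>dp \<and> dx = \<zeta> \<and> dx\<close> because \<open>\<zeta> - dp\<close> is a multiple of \<open>dx\<close>.\<close>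

lemma twist_eq: "(if i = 1 \<and> j = 4 then 1 else if i = 4 \<and> j = 1 then -1 else 0) = form_x i s * form_zeta j s - form_zeta i s * form_x j s"
proof -
  have "\<forall>i j. (if i = 1 \<and> j = 4 then 1 else if i = 4 \<and> j = 1 then -1 else 0) = form_x i s * form_zeta j s - form_zeta i s * form_x j s"
    unfolding forall_5 by (simp add: form_x_def form_zeta_def)
  then show ?thesis by blast
qed

text \<open>The metric in the coframe. The coefficient \<open>4/5\<close> is twice the \<open>2/5\<close> in \<open>\<theta>\<^sup>4\<close>.\<close>

definition h :: "5 \<Rightarrow> 5 \<Rightarrow> real \<Rightarrow> real" where
  "h i j s = (form_x i s * form_eta j s + form_eta i s * form_x j s) / \<rho> s - 4/5 * (X s / \<rho> s) * (form_eta i s * form_eta j s)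
     + 4/3 * ((form_zeta i s + B s * form_eta i s) * (form_zeta j s + B s * form_eta j s))"

definition Dh :: "5 \<Rightarrow> 5 \<Rightarrow> real \<Rightarrow> real" where
  "Dh i j s = 4 * B s * (form_x i s * form_eta j s + form_eta i s * form_x j s) + (form_x i s * form_zeta j s + form_zeta i s * form_x j s)
     - 4/5 * (4 * B s * X s + Y s / \<rho> s) * (form_eta i s * form_eta j s) - 4/5 * X s * (form_eta i s * form_zeta j s + form_zeta i s * form_eta j s)
     + 4/3 * ((- form_x i s + ((B s)\<^sup>2 * \<rho> s + X s) * form_eta i s + B s * \<rho> s * form_zeta i s) * (form_zeta j s + B s * form_eta j s)
       + (form_zeta i s + B s * form_eta i s) * (- form_x j s + ((B s)\<^sup>2 * \<rho> s + X s) * form_eta j s + B s * \<rho> s * form_zeta j s))"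

lemma h_deriv:
  assumes "s \<in> J"
  shows "(h i j has_real_derivative f s * Dh i j s) (at s)"
  unfolding h_def[abs_def] Dh_def
  using \<rho>_nz[OF assms]
  by (auto intro!: derivative_eq_intros coframe_deriv[OF assms] \<rho>_deriv[OF assms] B_deriv[OF assms] X_deriv[OF assms]
     simp: field_simps power2_eq_square)

text \<open>The rows of the matrix \<open>N\<close> with respect to the frame, found by solving \<open>h N = (Dh + F) / 2\<close> with
\<open>F\<close> the matrix of \<open>d(p dx)\<close>. All entries are polynomials in \<open>\<rho>, B, X, Y\<close>.\<close>

definition row_x :: "5 \<Rightarrow> real \<Rightarrow> real" where
  "row_x j s = 2 * B s * \<rho> s * form_x j s + (8/15 * B s * \<rho> s * X s - 2/5 * Y s) * form_eta j s + 8/15 * \<rho> s * X s * form_zeta j s"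
definition row_eta :: "5 \<Rightarrow> real \<Rightarrow> real" where
  "row_eta j s = 4/3 * B s * \<rho> s * form_eta j s + \<rho> s / 3 * form_zeta j s"
definition row_zeta :: "5 \<Rightarrow> real \<Rightarrow> real" where
  "row_zeta j s = - (1/2) * form_x j s + (X s / 5 - (B s)\<^sup>2 * \<rho> s / 3) * form_eta j s + 2/3 * B s * \<rho> s * form_zeta j s"

definition N :: "5 \<Rightarrow> 5 \<Rightarrow> real \<Rightarrow> real" where
  "N i j s = vec_x i s * row_x j s + vec_eta i s * row_eta j s + vec_zeta i s * row_zeta j s"

text \<open>The value that the Riccati equation demands, with \<open>\<mu> = 6/5 \<rho> X - 2 \<rho>\<^sup>2 B\<^sup>2\<close>; that it is the derivative
of \<open>N\<close> is lemma \<open>N_deriv\<close>.\<close>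

definition DN :: "5 \<Rightarrow> 5 \<Rightarrow> real \<Rightarrow> real" where
  "DN i j s = (6/5 * X s * \<rho> s - 2 * (B s)\<^sup>2 * (\<rho> s)\<^sup>2) * (if i = j \<and> i \<noteq> 2 \<and> i \<noteq> 5 then 1 else 0)
     - (\<Sum>m\<in>UNIV. N i m s * N m j s)"

lemma contract_frame:
  "(\<Sum>m\<in>UNIV. form_x m s * N m j s) = row_x j s"
  "(\<Sum>m\<in>UNIV. form_eta m s * N m j s) = row_eta j s"
  "(\<Sum>m\<in>UNIV. form_zeta m s * N m j s) = row_zeta j s"
  by (simp_all add: sum_5 N_def form_x_def form_eta_def form_zeta_def vec_x_def vec_eta_def vec_zeta_def algebra_simps)

text \<open>In the frame, squaring \<open>N\<close> means applying its own rows once more.\<close>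

lemma N_squared: "(\<Sum>m\<in>UNIV. N i m s * N m j s) =
    vec_x i s * (2 * B s * \<rho> s * row_x j s + (8/15 * B s * \<rho> s * X s - 2/5 * Y s) * row_eta j s + 8/15 * \<rho> s * X s * row_zeta j s)
    + vec_eta i s * (4/3 * B s * \<rho> s * row_eta j s + \<rho> s / 3 * row_zeta j s)
    + vec_zeta i s * (- (1/2) * row_x j s + (X s / 5 - (B s)\<^sup>2 * \<rho> s / 3) * row_eta j s + 2/3 * B s * \<rho> s * row_zeta j s)"
  unfolding contract_frame[symmetric] sum_distrib_left sum.distrib[symmetric]
  by (intro sum.cong refl) (simp add: N_def[of i] row_x_def[of _ s] row_eta_def[of _ s] row_zeta_def[of _ s] algebra_simps)

lemma lower:
  assumes "s \<in> J"
  shows "(\<Sum>m\<in>UNIV. h i m s * N m j s) =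
     (Dh i j s + (if i = 1 \<and> j = 4 then 1 else if i = 4 \<and> j = 1 then -1 else 0)) / 2"
proof -
  have "(\<Sum>m\<in>UNIV. h i m s * N m j s) =
      form_x i s / \<rho> s * row_eta j s + form_eta i s / \<rho> s * row_x j s - 4/5 * (X s / \<rho> s) * form_eta i s * row_eta j s
      + 4/3 * (form_zeta i s + B s * form_eta i s) * (row_zeta j s + B s * row_eta j s)"
    unfolding contract_frame[symmetric] sum_distrib_left sum.distrib[symmetric] sum_subtractf[symmetric]
    by (intro sum.cong refl) (simp add: h_def algebra_simps add_divide_distrib)
  also have "\<dots> = (Dh i j s + (form_x i s * form_zeta j s - form_zeta i s * form_x j s)) / 2"
    using \<rho>_nz[OF assms] by (simp add: Dh_def row_x_def row_eta_def row_zeta_def field_simps power2_eq_square)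
  finally show ?thesis unfolding twist_eq[of i j s] .
qed

text \<open>After inserting the derivatives of the frame, both sides are polynomials in \<open>\<rho>, B, X, Y\<close> in each
component. The derivative of \<open>Y\<close> occurs in the component \<open>vec_x \<otimes> form_eta\<close> only.\<close>

lemma N_deriv:
  assumes "s \<in> J"
  shows "(N i j has_real_derivative f s * DN i j s) (at s)"
proof -
  have DN: "DN i j s = (6/5 * X s * \<rho> s - 2 * (B s)\<^sup>2 * (\<rho> s)\<^sup>2) * (vec_x i s * form_x j s + vec_eta i s * form_eta j s + vec_zeta i s * form_zeta j s) -
   (vec_x i s * (2 * B s * \<rho> s * row_x j s + (8/15 * B s * \<rho> s * X s - 2/5 * Y s) * row_eta j s + 8/15 * \<rho> s * X s * row_zeta j s)
    + vec_eta i s * (4/3 * B s * \<rho> s * row_eta j s + \<rho> s / 3 * row_zeta j s)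
    + vec_zeta i s * (- (1/2) * row_x j s + (X s / 5 - (B s)\<^sup>2 * \<rho> s / 3) * row_eta j s + 2/3 * B s * \<rho> s * row_zeta j s))"
    unfolding DN_def N_squared frame_complete ..
  show ?thesis
    unfolding N_def[abs_def] row_x_def[abs_def] row_eta_def[abs_def] row_zeta_def[abs_def] DN
    by (auto intro!: derivative_eq_intros coframe_deriv[OF assms] frame_deriv[OF assms]
        \<rho>_deriv[OF assms] B_deriv[OF assms] X_deriv[OF assms] Y_deriv[OF assms])
      (simp add: row_x_def row_eta_def row_zeta_def field_simps power2_eq_square)
qed

text \<open>For a vector \<open>x\<close> in the kernel, the rows \<open>z\<close>, \<open>p\<close> and \<open>x\<close> say in turn that the coefficients of \<open>\<eta>\<close>, \<open>\<zeta>\<close> and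
\<open>dx\<close> in the 1-form \<open>h(x, \<cdot>)\<close> vanish.\<close>

lemma h_nondeg:
  assumes s: "s \<in> J" and 0: "\<And>i. (\<Sum>j\<in>UNIV. h i j s * x j) = 0"
  shows "x 1 = 0 \<and> x 3 = 0 \<and> x 4 = 0"
proof -
  let ?x = "\<Sum>j\<in>UNIV. form_x j s * x j" and ?n = "\<Sum>j\<in>UNIV. form_eta j s * x j" and ?z = "\<Sum>j\<in>UNIV. form_zeta j s * x j"
  have hx: "form_x i s / \<rho> s * ?n + form_eta i s / \<rho> s * ?x - 4/5 * (X s / \<rho> s) * form_eta i s * ?n
      + 4/3 * (form_zeta i s + B s * form_eta i s) * (?z + B s * ?n) = 0" for i
    unfolding 0[of i, symmetric] sum_distrib_left sum.distrib[symmetric] sum_subtractf[symmetric]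
    by (intro sum.cong refl) (simp add: h_def algebra_simps add_divide_distrib)
  have ev: "form_x 3 s = 0" "form_eta 3 s = - 1" "form_zeta 3 s = 0" "form_x 4 s = 0" "form_zeta 4 s = 1" "form_x 1 s = 1"
    by (simp_all add: form_x_def form_eta_def form_zeta_def)
  have c: "?x / \<rho> s - 4/5 * (X s / \<rho> s) * ?n + 4/3 * B s * (?z + B s * ?n) = 0"
    using hx[of 3] by (simp add: ev algebra_simps)
  have "form_eta 4 s * (?x / \<rho> s - 4/5 * (X s / \<rho> s) * ?n + 4/3 * B s * (?z + B s * ?n)) + 4/3 * (?z + B s * ?n) = 0"
    using hx[of 4] by (simp add: ev algebra_simps)
  then have zn: "?z + B s * ?n = 0" unfolding c by simp
  have "?n / \<rho> s + form_eta 1 s * (?x / \<rho> s - 4/5 * (X s / \<rho> s) * ?n + 4/3 * B s * (?z + B s * ?n)) + form_zeta 1 s * (4/3 * (?z + B s * ?n)) = 0"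
    using hx[of 1] by (simp add: ev algebra_simps)
  then have n: "?n = 0" unfolding c using \<rho>_nz[OF s] by (simp add: zn)
  with zn c have "?x = 0" "?z = 0" using \<rho>_nz[OF s] by simp_all
  with n show ?thesis by (simp add: sum_5 form_x_def form_eta_def form_zeta_def)
qed

theorem conformally_flat_metric:
  fixes g :: "5 metric"
  assumes metric: "\<And>q i j. q $ 5 \<in> J \<Longrightarrow> g q $ i $ j = h i j (q $ 5)
        + (if i = 2 \<and> j = 5 \<or> i = 5 \<and> j = 2 then - f (q $ 5) else 0)
        + q $ 4 * (if i = 1 \<and> j = 5 \<or> i = 5 \<and> j = 1 then f (q $ 5) else 0)"
  shows "pseudo_metric_on {q. q $ 5 \<in> J} g" "conformally_flat_on {q. q $ 5 \<in> J} g"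
proof -
  interpret plane_wave J f f' "\<lambda>s. 6/5 * X s * \<rho> s - 2 * (B s)\<^sup>2 * (\<rho> s)\<^sup>2" h Dh N DN g
  proof
    show "h i j = h j i" for i j
      by (simp add: h_def[abs_def] mult.commute add.commute)
    show "h 2 i s = 0" "h 5 i s = 0" for i s
      by (simp_all add: h_def form_x_def form_eta_def form_zeta_def)
    show "N 2 i s = 0" "N 5 i s = 0" "N i 2 s = 0" "N i 5 s = 0" for i s
      by (simp_all add: N_def row_x_def row_eta_def row_zeta_def form_x_def form_eta_def form_zeta_def vec_x_def vec_eta_def vec_zeta_def)
    show "DN i j s + (\<Sum>m\<in>UNIV. N i m s * N m j s) =
        (if i = j \<and> i \<noteq> 2 \<and> i \<noteq> 5 then 6/5 * X s * \<rho> s - 2 * (B s)\<^sup>2 * (\<rho> s)\<^sup>2 else 0)" for i j s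
      unfolding DN_def by auto
  qed (fact J f_deriv f_nz h_deriv N_deriv h_nondeg lower metric)+
  show "pseudo_metric_on {q. q $ 5 \<in> J} g" "conformally_flat_on {q. q $ 5 \<in> J} g"
    by (fact pseudo_metric conformally_flat)+
qed

end

section \<open>Conformal flatness for the hypergeometric equation\<close>

text \<open>The coefficients of the hypergeometric equation in the form \<open>w'' = P w' + Q w\<close>.\<close>

definition hg_P :: "real \<times> real \<times> real \<Rightarrow> real \<Rightarrow> real" where
  "hg_P T s = (case T of (a, b, c) \<Rightarrow> ((a + b + 1) * s - c) / (s * (1 - s)))"

definition hg_Q :: "real \<times> real \<times> real \<Rightarrow> real \<Rightarrow> real" where
  "hg_Q T s = (case T of (a, b, c) \<Rightarrow> a * b / (s * (1 - s)))"

lemma hg_solution_iff: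
  assumes "0 \<notin> J" "1 \<notin> J"
  shows "hg_solution T J w \<longleftrightarrow> (\<forall>s\<in>J. (w has_real_derivative deriv w s) (at s) \<and>
      (deriv w has_real_derivative hg_P T s * deriv w s + hg_Q T s * w s) (at s))"
proof -
  obtain a b c where T: "T = (a, b, c)" by (cases T)
  have "(w field_differentiable (at s) \<and> deriv w field_differentiable (at s) \<and>
        s * (1 - s) * deriv (deriv w) s + (c - (a + b + 1) * s) * deriv w s - a * b * w s = 0) \<longleftrightarrow>
      (w has_real_derivative deriv w s) (at s) \<and>
      (deriv w has_real_derivative hg_P T s * deriv w s + hg_Q T s * w s) (at s)" if "s \<in> J" for s
  proof -
    have nz: "s * (1 - s) \<noteq> 0" using assms that by auto
    have "s * (1 - s) * d + (c - (a + b + 1) * s) * deriv w s - a * b * w s = 0 \<longleftrightarrow>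
        d = hg_P T s * deriv w s + hg_Q T s * w s" for d
    proof -
      have eq: "hg_P T s * deriv w s + hg_Q T s * w s =
          (((a + b + 1) * s - c) * deriv w s + a * b * w s) / (s * (1 - s))"
        by (simp add: T hg_P_def hg_Q_def add_divide_distrib)
      show ?thesis
        unfolding eq nonzero_eq_divide_eq[OF nz] by (auto simp: algebra_simps)
    qed
    then show ?thesis
      by (metis DERIV_deriv_iff_field_differentiable DERIV_imp_deriv field_differentiable_def)
  qed
  then show ?thesis unfolding hg_solution_def T by auto
qed

definition hg_P' :: "real \<times> real \<times> real \<Rightarrow> real \<Rightarrow> real" where
  "hg_P' T s = (case T of (a, b, c) \<Rightarrow>
     (a + b + 1) / (s * (1 - s)) - ((a + b + 1) * s - c) * (1 - 2 * s) / (s * (1 - s))\<^sup>2)"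

definition hg_Q' :: "real \<times> real \<times> real \<Rightarrow> real \<Rightarrow> real" where
  "hg_Q' T s = (case T of (a, b, c) \<Rightarrow> - (a * b * (1 - 2 * s)) / (s * (1 - s))\<^sup>2)"

definition hg_Q'' :: "real \<times> real \<times> real \<Rightarrow> real \<Rightarrow> real" where
  "hg_Q'' T s = (case T of (a, b, c) \<Rightarrow>
     2 * a * b / (s * (1 - s))\<^sup>2 + 2 * a * b * (1 - 2 * s)\<^sup>2 / (s * (1 - s)) ^ 3)"

lemma hg_coeff_deriv:
  assumes "s \<noteq> 0" "s \<noteq> 1"
  shows "(hg_P T has_real_derivative hg_P' T s) (at s)" (is ?P)
    "(hg_Q T has_real_derivative hg_Q' T s) (at s)" (is ?Q)
    "(hg_Q' T has_real_derivative hg_Q'' T s) (at s)" (is ?Q')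
proof -
  have nz: "s * (1 - s) \<noteq> 0" using assms by auto
  obtain a b c where T: "T = (a, b, c)" by (cases T)
  have d: "((\<lambda>s. s * (1 - s)) has_real_derivative 1 - 2 * s) (at s)"
    by (auto intro!: derivative_eq_intros)
  define u where "u = (\<lambda>s::real. s * (1 - s))"
  have u: "u s \<noteq> 0" "(u has_real_derivative 1 - 2 * s) (at s)"
    using nz d by (simp_all add: u_def)
  have fold: "s * (1 - s) = u s" for s by (simp add: u_def)
  note defs = hg_P_def[abs_def] hg_Q_def[abs_def] hg_P'_def hg_Q'_def[abs_def] hg_Q''_def
  show ?P ?Q ?Q'
    unfolding T defs prod.case fold
    using u(1) by (auto intro!: derivative_eq_intros u(2) simp: field_simps power2_eq_square power3_eq_cube)
qed

text \<open>Over the common denominator \<open>u\<^sup>3\<close>, \<open>u = s (1 - s)\<close>, the left side has the numerator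
\<open>a b ((2 t + 3 n) (t + 2 n) - 2 (a + b) u)\<close>. At \<open>s = 0\<close> its first term is \<open>(2 - 3 c) (1 - 2 c)\<close>, which explains
the values \<open>1/2\<close> and \<open>2/3\<close> of \<open>c\<close>.\<close>

lemma hg_triple_condition:
  assumes T: "T \<in> hg_triples" and s: "s \<noteq> 0" "s \<noteq> 1"
  shows "hg_Q'' T s - 5 * hg_P T s * hg_Q' T s - 2 * hg_P' T s * hg_Q T s + 6 * (hg_P T s)\<^sup>2 * hg_Q T s
     = 8/5 * (hg_Q T s)\<^sup>2"
proof -
  obtain a b c where abc: "T = (a, b, c)" by (cases T)
  define n where "n = (a + b + 1) * s - c"
  define t where "t = 1 - 2 * s"
  define u where "u = s * (1 - s)"
  have u: "u \<noteq> 0" using s by (simp add: u_def)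
  have key: "(2 * t + 3 * n) * (t + 2 * n) = (8/5 * (a * b) + 2 * (a + b)) * u"
  proof -
    have "a = - 1/4 \<and> b = 5/12 \<and> c = 1/2 \<or> a = - 1/4 \<and> b = 5/12 \<and> c = 2/3 \<or> a = - 1/2 \<and> b = 5/6 \<and> c = 2/3"
      using T by (auto simp: abc hg_triples_def)
    then show ?thesis
      unfolding n_def t_def u_def by (elim disjE conjE; hypsubst; simp add: field_simps)
  qed
  have "hg_Q'' T s - 5 * hg_P T s * hg_Q' T s - 2 * hg_P' T s * hg_Q T s + 6 * (hg_P T s)\<^sup>2 * hg_Q T s
      = a * b * ((2 * t + 3 * n) * (t + 2 * n) - 2 * (a + b) * u) / u ^ 3"
    unfolding abc hg_P_def hg_Q_def hg_P'_def hg_Q'_def hg_Q''_def prod.case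
      n_def[symmetric] t_def[symmetric] u_def[symmetric]
    using u by (simp add: field_simps power2_eq_square power3_eq_cube)
  also have "\<dots> = 8/5 * (hg_Q T s)\<^sup>2"
    unfolding key abc hg_Q_def prod.case u_def[symmetric]
    using u by (simp add: field_simps power2_eq_square power3_eq_cube)
  finally show ?thesis .
qed

lemma wronskian_deriv:
  assumes "0 \<notin> J" "1 \<notin> J" "hg_solution T J u" "hg_solution T J v" "s \<in> J"
  shows "(wronskian u v has_real_derivative hg_P T s * wronskian u v s) (at s)"
proof -
  have "(u has_real_derivative deriv u s) (at s)" "(v has_real_derivative deriv v s) (at s)"
    "(deriv u has_real_derivative hg_P T s * deriv u s + hg_Q T s * u s) (at s)"
    "(deriv v has_real_derivative hg_P T s * deriv v s + hg_Q T s * v s) (at s)"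
    using assms hg_solution_iff by auto
  then show ?thesis
    unfolding wronskian_def[abs_def] by (auto intro!: derivative_eq_intros simp: algebra_simps)
qed

text \<open>The products with \<open>ds\<close> in \<open>\<theta>\<^sup>1 \<theta>\<^sup>5\<close> and \<open>\<theta>\<^sup>2 \<theta>\<^sup>4\<close> cancel except for \<open>(dy - p dx) ds\<close>, which leaves a metric of
the form treated above. In \<open>\<theta>\<^sup>4\<close> the second derivatives combine to \<open>Q W\<close>.\<close>

theorem nurowski_conformally_flat:
  assumes T: "T \<in> hg_triples" and J: "hg_interval J"
    and w: "hg_solution T J w1" "hg_solution T J w2"
    and nz: "\<And>s. s \<in> J \<Longrightarrow> w1 s \<noteq> 0" "\<And>s. s \<in> J \<Longrightarrow> wronskian w1 w2 s \<noteq> 0"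
    and IK: "antiderivatives_on J w1 w2 I K"
  shows "pseudo_metric_on {q. q $ 5 \<in> J} (nurowski_metric w1 w2 I K) \<and>
      conformally_flat_on {q. q $ 5 \<in> J} (nurowski_metric w1 w2 I K)"
proof -
  have J01: "0 \<notin> J" "1 \<notin> J" and "open J" using J by (auto simp: hg_interval_def)
  define W where "W = wronskian w1 w2"
  \<comment> \<open>\<open>f\<close> is the derivative of \<open>I\<close>, so \<open>u = I(s)\<close>.\<close>
  define f where "f s = (w1 s)\<^sup>2 * W s" for s
  define f' where "f' s = 2 * w1 s * deriv w1 s * W s + (w1 s)\<^sup>2 * (hg_P T s * W s)" for s
  define \<rho> where "\<rho> s = 1 / w1 s ^ 4" for s
  define B where "B s = w1 s * deriv w1 s / W s" for s
  define X where "X s = hg_Q T s / (W s)\<^sup>2" for s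
  define Y where "Y s = (hg_Q' T s - 2 * hg_P T s * hg_Q T s) / ((w1 s)\<^sup>2 * W s ^ 3)" for s
  define r where "r s = w2 s / w1 s" for s
  have W_nz: "W s \<noteq> 0" if "s \<in> J" for s using nz(2)[OF that] by (simp add: W_def)
  have W_eq: "W s = w1 s * deriv w2 s - w2 s * deriv w1 s" for s by (simp add: W_def wronskian_def)
  note w' = w[unfolded hg_solution_iff[OF J01]]
  have d: "(w1 has_real_derivative deriv w1 s) (at s)" "(w2 has_real_derivative deriv w2 s) (at s)"
    "(deriv w1 has_real_derivative hg_P T s * deriv w1 s + hg_Q T s * w1 s) (at s)"
    "(W has_real_derivative hg_P T s * W s) (at s)"
    "(hg_P T has_real_derivative hg_P' T s) (at s)"
    "(hg_Q T has_real_derivative hg_Q' T s) (at s)"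
    "(hg_Q' T has_real_derivative hg_Q'' T s) (at s)"
    if "s \<in> J" for s
  proof -
    have "s \<noteq> 0" "s \<noteq> 1" using J01 that by auto
    from hg_coeff_deriv[OF this, of T]
    show "(hg_P T has_real_derivative hg_P' T s) (at s)"
      "(hg_Q T has_real_derivative hg_Q' T s) (at s)"
      "(hg_Q' T has_real_derivative hg_Q'' T s) (at s)" by auto
    show "(W has_real_derivative hg_P T s * W s) (at s)"
      unfolding W_def by (rule wronskian_deriv[OF J01 w that])
  qed (use w' that in auto)
  interpret frame_system J f f' \<rho> B X Y r I K
  proof
    fix s assume s: "s \<in> J"
    note nzs = nz(1)[OF s] W_nz[OF s]
    note ds = d[OF s]
    show "(f has_real_derivative f' s) (at s)"
      unfolding f_def[abs_def] f'_def by (auto intro!: derivative_eq_intros ds simp: power2_eq_square)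
    show "f s \<noteq> 0" "\<rho> s \<noteq> 0" using nzs by (auto simp: f_def \<rho>_def)
    show "(\<rho> has_real_derivative f s * (- 4 * B s * (\<rho> s)\<^sup>2)) (at s)"
      unfolding \<rho>_def[abs_def] f_def B_def
      by (rule derivative_eq_intros ds refl | use nzs in \<open>simp add: field_simps eval_nat_numeral\<close>)+
    show "(B has_real_derivative f s * ((B s)\<^sup>2 * \<rho> s + X s)) (at s)"
      unfolding \<rho>_def[abs_def] f_def B_def[abs_def] X_def
      by (rule derivative_eq_intros ds refl | use nzs in \<open>simp add: field_simps eval_nat_numeral\<close>)+
    show "(X has_real_derivative f s * Y s) (at s)"
      unfolding X_def[abs_def] f_def Y_def
      by (rule derivative_eq_intros ds refl | use nzs in \<open>simp add: field_simps eval_nat_numeral\<close>)+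
    show "(Y has_real_derivative f s * (8/5 * \<rho> s * (X s)\<^sup>2 - 2 * B s * \<rho> s * Y s)) (at s)"
    proof -
      \<comment> \<open>The first part contains the combination that the triples make equal to \<open>8/5 Q\<^sup>2\<close>, the second is \<open>- 2 f B \<rho> Y\<close>.\<close>
      have "(Y has_real_derivative
         (hg_Q'' T s - 5 * hg_P T s * hg_Q' T s - 2 * hg_P' T s * hg_Q T s + 6 * (hg_P T s)\<^sup>2 * hg_Q T s)
           / ((w1 s)\<^sup>2 * W s ^ 3)
         - 2 * (hg_Q' T s - 2 * hg_P T s * hg_Q T s) * deriv w1 s / (w1 s ^ 3 * W s ^ 3)) (at s)"
        unfolding Y_def[abs_def]
        by (rule derivative_eq_intros ds refl | use nzs in \<open>simp add: field_simps eval_nat_numeral\<close>)+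
      also have "hg_Q'' T s - 5 * hg_P T s * hg_Q' T s - 2 * hg_P' T s * hg_Q T s + 6 * (hg_P T s)\<^sup>2 * hg_Q T s
          = 8/5 * (hg_Q T s)\<^sup>2"
        using T J01 s by (intro hg_triple_condition) auto
      also have "8/5 * (hg_Q T s)\<^sup>2 / ((w1 s)\<^sup>2 * W s ^ 3)
         - 2 * (hg_Q' T s - 2 * hg_P T s * hg_Q T s) * deriv w1 s / (w1 s ^ 3 * W s ^ 3)
         = f s * (8/5 * \<rho> s * (X s)\<^sup>2 - 2 * B s * \<rho> s * Y s)"
        using nzs by (simp add: f_def \<rho>_def X_def B_def Y_def field_simps eval_nat_numeral)
      finally show ?thesis .
    qed
    show "(r has_real_derivative f s * \<rho> s) (at s)"
      unfolding r_def[abs_def] f_def \<rho>_def W_eq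
      by (rule derivative_eq_intros ds refl | use nzs in \<open>simp add: field_simps eval_nat_numeral\<close>)+
    show "(I has_real_derivative f s) (at s)"
      using IK s by (auto simp: antiderivatives_on_def f_def W_def)
    have "(K has_real_derivative I s * (W s / (w1 s)\<^sup>2)) (at s)"
      using IK s by (auto simp: antiderivatives_on_def W_def)
    also have "I s * (W s / (w1 s)\<^sup>2) = f s * (I s * \<rho> s)"
      using nzs by (simp add: f_def \<rho>_def field_simps eval_nat_numeral)
    finally show "(K has_real_derivative f s * (I s * \<rho> s)) (at s)" .
  qed (fact \<open>open J\<close>)
  have metric: "nurowski_metric w1 w2 I K q $ i $ j = h i j (q $ 5)
        + (if i = 2 \<and> j = 5 \<or> i = 5 \<and> j = 2 then - f (q $ 5) else 0)
        + q $ 4 * (if i = 1 \<and> j = 5 \<or> i = 5 \<and> j = 1 then f (q $ 5) else 0)" if s: "q $ 5 \<in> J" for q i j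
  proof -
    let ?s = "q $ 5"
    note nzs = nz(1)[OF s] W_nz[OF s]
    have "deriv (deriv w1) ?s = hg_P T ?s * deriv w1 ?s + hg_Q T ?s * w1 ?s"
      "deriv (deriv w2) ?s = hg_P T ?s * deriv w2 ?s + hg_Q T ?s * w2 ?s"
      using w' s by (auto intro: DERIV_imp_deriv)
    then have Q: "deriv (deriv w1) ?s * deriv w2 ?s - deriv (deriv w2) ?s * deriv w1 ?s = hg_Q T ?s * W ?s"
      by (simp add: W_eq algebra_simps)
    \<comment> \<open>The combination that occurs in \<open>\<theta>\<^sup>1\<close>, \<open>\<theta>\<^sup>2\<close> and \<open>\<theta>\<^sup>4\<close> is \<open>\<eta>\<close>, since the terms with \<open>I\<close> cancel.\<close>
    have form_eta: "((w2 ?s / w1 ?s) *\<^sub>R \<omega>2 I q - \<omega>3 w1 w2 I K q) $ i = form_eta i ?s" for i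
      using exhaust_5[of i] by (auto simp: \<omega>2_def \<omega>3_def form_eta_def r_def axis_def Let_def algebra_simps)
    have form_zeta: "\<omega>2 I q $ i = form_zeta i ?s" for i
      using exhaust_5[of i] by (auto simp: \<omega>2_def form_zeta_def axis_def)
    have \<theta>2: "\<theta>2 w1 w2 I K q $ i = form_eta i ?s / \<rho> ?s" for i
      unfolding \<theta>2_def Let_def vector_scaleR_component form_eta by (simp add: \<rho>_def)
    have \<theta>1: "\<theta>1 w1 w2 I K q $ i = (if i = 2 then 1 else 0) - q $ 4 * (if i = 1 then 1 else 0) - form_eta i ?s / \<rho> ?s" for i
      using \<theta>2[of i] by (simp add: \<theta>1_def \<theta>2_def \<omega>1_def axis_def Let_def)
    have \<theta>5: "\<theta>5 w1 w2 q $ i = - f ?s * (if i = 5 then 1 else 0)" for i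
      by (simp add: \<theta>5_def \<omega>4_def Let_def f_def W_def axis_def)
    have \<theta>4: "\<theta>4 w1 w2 I K q $ i = 2/5 * X ?s * form_eta i ?s + f ?s * (if i = 5 then 1 else 0) - form_x i ?s" for i
      unfolding \<theta>4_def Let_def vector_minus_component vector_add_component vector_scaleR_component
        form_eta[unfolded vector_minus_component vector_scaleR_component] Q
      using nzs by (simp add: \<omega>4_def \<omega>5_def form_x_def axis_def Let_def f_def X_def flip: W_def)
        (simp add: field_simps eval_nat_numeral)
    have \<theta>3: "\<theta>3 w1 w2 I K q $ i = form_zeta i ?s + B ?s * form_eta i ?s" for i
      unfolding \<theta>3_def Let_def form_eta[symmetric] form_zeta[symmetric]
      using nzs by (simp add: B_def flip: W_def) (simp add: field_simps)
    have "nurowski_metric w1 w2 I K q $ i $ j = h i j ?s - f ?s *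
       (((if i = 2 then 1 else 0) - q $ 4 * (if i = 1 then 1 else 0)) * (if j = 5 then 1 else 0)
        + ((if j = 2 then 1 else 0) - q $ 4 * (if j = 1 then 1 else 0)) * (if i = 5 then 1 else 0))"
      unfolding nurowski_metric_def sym_prod_def h_def
      by (simp only: vector_minus_component vector_add_component vector_scaleR_component vec_lambda_beta \<theta>1 \<theta>2 \<theta>3 \<theta>4 \<theta>5)
        (simp add: algebra_simps add_divide_distrib diff_divide_distrib)
    then show ?thesis by auto
  qed
  show ?thesis
    using conformally_flat_metric[OF metric] by blast
qed

section \<open>Linear differential equations of second order\<close>

lemma open_interval_enclose:
  fixes S :: "real set"
  assumes "open S" "is_interval S" "x \<in> S" "y \<in> S"
  obtains c d where "{c..d} \<subseteq> S" "c < x" "c < y" "x < d" "y < d"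
proof -
  have "min x y \<in> S" "max x y \<in> S" using assms by (auto simp: min_def max_def)
  with \<open>open S\<close> obtain e1 e2 where "e1 > 0" "cball (min x y) e1 \<subseteq> S" "e2 > 0" "cball (max x y) e2 \<subseteq> S"
    by (meson open_contains_cball)
  then have "min x y - e1 \<in> S" "max x y + e2 \<in> S" by (auto simp: dist_real_def subset_iff)
  then have "{min x y - e1..max x y + e2} \<subseteq> S"
    using assms(2) unfolding is_interval_1 by (meson atLeastAtMost_iff subsetI)
  with \<open>e1 > 0\<close> \<open>e2 > 0\<close> show thesis by (intro that) auto
qed

lemma interval_antiderivative:
  fixes f :: "real \<Rightarrow> real"
  assumes S: "open S" "is_interval S" "t0 \<in> S" and f: "continuous_on S f"
  shows "\<exists>F. F t0 = 0 \<and> (\<forall>t\<in>S. (F has_real_derivative f t) (at t))"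
proof (intro exI[of _ "\<lambda>u::real. LBINT y=t0..u. f y"] conjI ballI)
  show "(LBINT y=t0..t0. f y) = 0" by simp
  fix t assume t: "t \<in> S"
  obtain c d where cd: "{c..d} \<subseteq> S" "c < t0" "c < t" "t0 < d" "t < d"
    using open_interval_enclose[OF S(1,2,3) t] by metis
  have cont: "continuous_on {c..d} f" by (rule continuous_on_subset[OF f cd(1)])
  have "((\<lambda>u. LBINT y=t0..u. f y) has_vector_derivative f t) (at t within {c..d})"
    by (rule interval_integral_FTC2[OF _ _ cont]) (use cd in auto)
  then have "((\<lambda>u. LBINT y=t0..u. f y) has_vector_derivative f t) (at t within {c<..<d})"
    by (rule has_vector_derivative_within_subset) auto
  moreover have "at t within {c<..<d} = at t"
    using cd by (intro at_within_open) auto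
  ultimately show "((\<lambda>u. LBINT y=t0..u. f y) has_real_derivative f t) (at t)"
    unfolding has_real_derivative_iff_has_vector_derivative by simp
qed

text \<open>In the supremum norm with weight \<open>exp (- 2 M \<bar>t - t0\<bar>)\<close>, integration from \<open>t0\<close> has norm at most \<open>1 / (2 M)\<close> on
intervals of any length.\<close>

lemma weighted_bound:
  fixes F G :: "real \<Rightarrow> real"
  assumes F: "\<And>t. t \<in> {c..d} \<Longrightarrow> (F has_real_derivative G t) (at t)" and "F t0 = 0"
    and G: "\<And>t. t \<in> {c..d} \<Longrightarrow> \<bar>G t\<bar> \<le> M * (C * exp (2 * M * \<bar>t - t0\<bar>))"
    and t0: "t0 \<in> {c..d}" and t: "t \<in> {c..d}" and C: "C \<ge> 0"
  shows "\<bar>F t\<bar> \<le> C / 2 * exp (2 * M * \<bar>t - t0\<bar>)"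
proof -
  have cont: "continuous_on {c..d} F"
    using F by (meson DERIV_isCont continuous_at_imp_continuous_on)
  have cont1: "continuous_on {t0..t} F" and cont2: "continuous_on {t..t0} F"
    using t0 t by (auto intro: continuous_on_subset[OF cont])
  consider "t = t0" | "t0 < t" | "t < t0" by linarith
  then show ?thesis
  proof cases
    case 1
    then show ?thesis using assms(2) C by simp
  next
    case 2
    have "norm (F t - F t0) \<le> C / 2 * exp (2 * M * (t - t0)) - C / 2 * exp (2 * M * (t0 - t0))"
    proof (rule differentiable_bound_general[OF 2, where f' = G and \<phi>' = "\<lambda>x. M * (C * exp (2 * M * (x - t0)))"])
      fix x assume x: "t0 < x" "x < t"
      then have x': "x \<in> {c..d}" using t0 t by auto
      show "(F has_vector_derivative G x) (at x)"
        using F[OF x'] by (simp add: has_real_derivative_iff_has_vector_derivative)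
      show "((\<lambda>t. C / 2 * exp (2 * M * (t - t0))) has_vector_derivative M * (C * exp (2 * M * (x - t0)))) (at x)"
        unfolding has_real_derivative_iff_has_vector_derivative[symmetric]
        by (auto intro!: derivative_eq_intros)
      show "norm (G x) \<le> M * (C * exp (2 * M * (x - t0)))"
        using G[OF x'] x by simp
    qed (use cont1 t0 t in \<open>auto intro!: continuous_intros\<close>)
    then show ?thesis using 2 C assms(2) by simp
  next
    case 3
    have "norm (F t0 - F t) \<le> - (C / 2 * exp (2 * M * (t0 - t0))) - (- (C / 2 * exp (2 * M * (t0 - t))))"
    proof (rule differentiable_bound_general[OF 3, where f' = G and \<phi>' = "\<lambda>x. M * (C * exp (2 * M * (t0 - x)))"])
      fix x assume x: "t < x" "x < t0"
      then have x': "x \<in> {c..d}" using t0 t by auto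
      show "(F has_vector_derivative G x) (at x)"
        using F[OF x'] by (simp add: has_real_derivative_iff_has_vector_derivative)
      show "((\<lambda>t. - (C / 2 * exp (2 * M * (t0 - t)))) has_vector_derivative M * (C * exp (2 * M * (t0 - x)))) (at x)"
        unfolding has_real_derivative_iff_has_vector_derivative[symmetric]
        by (auto intro!: derivative_eq_intros)
      show "norm (G x) \<le> M * (C * exp (2 * M * (t0 - x)))"
        using G[OF x'] x by simp
    qed (use cont2 t0 t in \<open>auto intro!: continuous_intros\<close>)
    then show ?thesis using 3 C assms(2) by simp
  qed
qed

lemma continuous_coeff_bound:
  fixes P Q :: "real \<Rightarrow> real"
  assumes "continuous_on {c..d} P" "continuous_on {c..d} Q"
  obtains M where "M \<ge> 1" "\<And>t. t \<in> {c..d} \<Longrightarrow> \<bar>P t\<bar> + \<bar>Q t\<bar> \<le> M"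
proof -
  have "bounded ((\<lambda>t. \<bar>P t\<bar> + \<bar>Q t\<bar>) ` {c..d})"
    by (intro compact_imp_bounded compact_continuous_image continuous_intros assms compact_Icc)
  then obtain B where "\<forall>t\<in>{c..d}. norm (\<bar>P t\<bar> + \<bar>Q t\<bar>) \<le> B"
    unfolding bounded_iff by auto
  then have "\<bar>P t\<bar> + \<bar>Q t\<bar> \<le> max 1 B" if "t \<in> {c..d}" for t
    using that by fastforce
  then show thesis by (intro that[of "max 1 B"]) auto
qed

lemma step_bound:
  fixes p q y z E M :: real
  assumes "\<bar>p\<bar> + \<bar>q\<bar> \<le> M" "\<bar>y\<bar> \<le> E" "\<bar>z\<bar> \<le> E"
  shows "\<bar>p * z + q * y\<bar> \<le> M * E"
proof -
  have "\<bar>p * z + q * y\<bar> \<le> \<bar>p\<bar> * \<bar>z\<bar> + \<bar>q\<bar> * \<bar>y\<bar>"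
    by (metis abs_mult abs_triangle_ineq)
  also have "\<dots> \<le> \<bar>p\<bar> * E + \<bar>q\<bar> * E"
    by (intro add_mono mult_left_mono assms) auto
  also have "\<dots> = (\<bar>p\<bar> + \<bar>q\<bar>) * E" by (simp add: algebra_simps)
  also have "\<dots> \<le> M * E" using assms by (intro mult_right_mono) auto
  finally show ?thesis .
qed

text \<open>One Picard step for the system \<open>y' = z\<close>, \<open>z' = P z + Q y\<close> halves the weighted norm. Existence and
uniqueness both follow from this.\<close>

lemma picard_step_bound:
  fixes P Q y z u v :: "real \<Rightarrow> real"
  assumes t0: "t0 \<in> {c..d}" and M: "M \<ge> 1" "\<And>t. t \<in> {c..d} \<Longrightarrow> \<bar>P t\<bar> + \<bar>Q t\<bar> \<le> M" and C: "C \<ge> 0"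
    and yz: "\<And>t. t \<in> {c..d} \<Longrightarrow> \<bar>y t\<bar> \<le> C * exp (2 * M * \<bar>t - t0\<bar>) \<and> \<bar>z t\<bar> \<le> C * exp (2 * M * \<bar>t - t0\<bar>)"
    and u: "\<And>t. t \<in> {c..d} \<Longrightarrow> (u has_real_derivative z t) (at t)" "u t0 = 0"
    and v: "\<And>t. t \<in> {c..d} \<Longrightarrow> (v has_real_derivative P t * z t + Q t * y t) (at t)" "v t0 = 0"
    and t: "t \<in> {c..d}"
  shows "\<bar>u t\<bar> \<le> C / 2 * exp (2 * M * \<bar>t - t0\<bar>) \<and> \<bar>v t\<bar> \<le> C / 2 * exp (2 * M * \<bar>t - t0\<bar>)"
proof
  show "\<bar>u t\<bar> \<le> C / 2 * exp (2 * M * \<bar>t - t0\<bar>)"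
  proof (rule weighted_bound[OF u _ t0 t C])
    fix t assume "t \<in> {c..d}"
    then have "\<bar>z t\<bar> \<le> C * exp (2 * M * \<bar>t - t0\<bar>)" using yz by blast
    also have "\<dots> \<le> M * (C * exp (2 * M * \<bar>t - t0\<bar>))"
      using mult_right_mono[OF M(1) mult_nonneg_nonneg[OF C exp_ge_zero]] by simp
    finally show "\<bar>z t\<bar> \<le> M * (C * exp (2 * M * \<bar>t - t0\<bar>))" .
  qed
  show "\<bar>v t\<bar> \<le> C / 2 * exp (2 * M * \<bar>t - t0\<bar>)"
  proof (rule weighted_bound[OF v _ t0 t C])
    fix t assume "t \<in> {c..d}"
    then show "\<bar>P t * z t + Q t * y t\<bar> \<le> M * (C * exp (2 * M * \<bar>t - t0\<bar>))"
      using M(2) yz by (intro step_bound) auto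
  qed
qed

text \<open>A solution with vanishing initial values is its own Picard step, so its weighted norm is zero.\<close>

lemma linear_ode_unique:
  fixes P Q y z :: "real \<Rightarrow> real"
  assumes S: "open S" "is_interval S" "t0 \<in> S"
    and PQ: "continuous_on S P" "continuous_on S Q"
    and y: "\<And>t. t \<in> S \<Longrightarrow> (y has_real_derivative z t) (at t)"
    and z: "\<And>t. t \<in> S \<Longrightarrow> (z has_real_derivative P t * z t + Q t * y t) (at t)"
    and 0: "y t0 = 0" "z t0 = 0" and t: "t \<in> S"
  shows "y t = 0"
proof -
  obtain c d where cd: "{c..d} \<subseteq> S" "c < t0" "c < t" "t0 < d" "t < d"
    using open_interval_enclose[OF S t] by metis
  obtain M where M: "M \<ge> 1" "\<And>t. t \<in> {c..d} \<Longrightarrow> \<bar>P t\<bar> + \<bar>Q t\<bar> \<le> M"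
    using continuous_coeff_bound[OF continuous_on_subset[OF PQ(1) cd(1)] continuous_on_subset[OF PQ(2) cd(1)]] by blast
  have "continuous_on {c..d} y"
    using y cd(1) by (meson DERIV_isCont continuous_at_imp_continuous_on subsetD)
  moreover have "continuous_on {c..d} z"
    using z cd(1) by (meson DERIV_isCont continuous_at_imp_continuous_on subsetD)
  ultimately obtain C where C: "C \<ge> 1" "\<And>t. t \<in> {c..d} \<Longrightarrow> \<bar>y t\<bar> + \<bar>z t\<bar> \<le> C"
    using continuous_coeff_bound by blast
  have bd: "\<forall>t\<in>{c..d}. \<bar>y t\<bar> \<le> C / 2 ^ n * exp (2 * M * \<bar>t - t0\<bar>) \<and> \<bar>z t\<bar> \<le> C / 2 ^ n * exp (2 * M * \<bar>t - t0\<bar>)" for n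
  proof (induction n)
    case 0
    have le: "C * 1 \<le> C * exp (2 * M * \<bar>t - t0\<bar>)" for t
      using C(1) M(1) by (intro mult_left_mono) auto
    have "\<bar>y t\<bar> \<le> C * exp (2 * M * \<bar>t - t0\<bar>) \<and> \<bar>z t\<bar> \<le> C * exp (2 * M * \<bar>t - t0\<bar>)"
      if "t \<in> {c..d}" for t
      using C(2)[OF that] le[of t] by linarith
    then show ?case by simp
  next
    case (Suc n)
    have "\<bar>y t\<bar> \<le> C / 2 ^ n / 2 * exp (2 * M * \<bar>t - t0\<bar>) \<and> \<bar>z t\<bar> \<le> C / 2 ^ n / 2 * exp (2 * M * \<bar>t - t0\<bar>)"
      if "t \<in> {c..d}" for t
      by (rule picard_step_bound[where P = P and Q = Q and y = y and z = z and c = c and d = d])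
        (use cd y z 0 C(1) M Suc.IH that in auto)
    then show ?case by (simp add: mult.commute)
  qed
  have "(\<lambda>n. C * exp (2 * M * \<bar>t - t0\<bar>) * (1/2) ^ n) \<longlonglongrightarrow> C * exp (2 * M * \<bar>t - t0\<bar>) * 0"
    by (intro tendsto_mult tendsto_const LIMSEQ_power_zero) auto
  moreover have "\<bar>y t\<bar> \<le> C * exp (2 * M * \<bar>t - t0\<bar>) * (1/2) ^ n" for n
    using bd[of n] cd by (auto simp: power_divide)
  ultimately have "\<bar>y t\<bar> \<le> C * exp (2 * M * \<bar>t - t0\<bar>) * 0" by (intro LIMSEQ_le_const) auto
  then show ?thesis by simp
qed

text \<open>The solution is the sum over all \<open>n\<close> of the iterates of the integral operator, applied to the constant
initial values. The terms are defined on all of \<open>S\<close>, and on compact subintervals the series converges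
like a geometric series.\<close>

lemma linear_ode_exists:
  fixes P Q :: "real \<Rightarrow> real"
  assumes S: "open S" "is_interval S" "t0 \<in> S"
    and PQ: "continuous_on S P" "continuous_on S Q"
  shows "\<exists>y z. (\<forall>t\<in>S. (y has_real_derivative z t) (at t)) \<and>
     (\<forall>t\<in>S. (z has_real_derivative P t * z t + Q t * y t) (at t)) \<and> y t0 = \<alpha> \<and> z t0 = \<beta>"
proof -
  define A where "A f = (SOME F. F t0 = 0 \<and> (\<forall>t\<in>S. (F has_real_derivative f t) (at t)))" for f :: "real \<Rightarrow> real"
  have A: "A f t0 = 0" "\<And>t. t \<in> S \<Longrightarrow> (A f has_real_derivative f t) (at t)" if "continuous_on S f" for f
    using someI_ex[OF interval_antiderivative[OF S that]] by (auto simp: A_def)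
  define w where "w = rec_nat (\<lambda>_::real. \<alpha>, \<lambda>_::real. \<beta>)
    (\<lambda>_ (y, z). (A z, A (\<lambda>t. P t * z t + Q t * y t)))"
  define u where "u n = fst (w n)" for n
  define v where "v n = snd (w n)" for n
  have rec: "u 0 = (\<lambda>_. \<alpha>)" "v 0 = (\<lambda>_. \<beta>)" "u (Suc n) = A (v n)" "v (Suc n) = A (\<lambda>t. P t * v n t + Q t * u n t)" for n
    by (simp_all add: u_def v_def w_def split: prod.splits)
  have cont: "continuous_on S (u n) \<and> continuous_on S (v n)" for n
  proof (induction n)
    case (Suc n)
    then have "continuous_on S (\<lambda>t. P t * v n t + Q t * u n t)" "continuous_on S (v n)"
      by (auto intro!: continuous_intros PQ)
    from A(2)[OF this(1)] A(2)[OF this(2)] show ?case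
      unfolding rec by (meson DERIV_isCont continuous_at_imp_continuous_on)
  qed (simp add: rec)
  have cont': "continuous_on S (\<lambda>t. P t * v n t + Q t * u n t)" for n
    using cont[of n] by (auto intro!: continuous_intros PQ)
  \<comment> \<open>The derivative of the term with index \<open>n\<close> involves the term before it, and for \<open>n = 0\<close> it vanishes.\<close>
  define du where "du = (\<lambda>n t. case n of 0 \<Rightarrow> 0 | Suc n \<Rightarrow> v n t)"
  define dv where "dv = (\<lambda>n t. case n of 0 \<Rightarrow> 0 | Suc n \<Rightarrow> P t * v n t + Q t * u n t)"
  have du: "(u n has_real_derivative du n t) (at t)" and dv: "(v n has_real_derivative dv n t) (at t)" if "t \<in> S" for n t
    using that A(2)[OF cont'] A(2) cont by (cases n; simp add: rec du_def dv_def)+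
  have main: "((\<lambda>t. \<Sum>n. u n t) has_real_derivative (\<Sum>n. v n t)) (at t) \<and>
      ((\<lambda>t. \<Sum>n. v n t) has_real_derivative P t * (\<Sum>n. v n t) + Q t * (\<Sum>n. u n t)) (at t)" if t: "t \<in> S" for t
  proof -
    obtain c d where cd: "{c..d} \<subseteq> S" "c < t0" "c < t" "t0 < d" "t < d"
      using open_interval_enclose[OF S t] by metis
    obtain M where M: "M \<ge> 1" "\<And>t. t \<in> {c..d} \<Longrightarrow> \<bar>P t\<bar> + \<bar>Q t\<bar> \<le> M"
      using continuous_coeff_bound[OF continuous_on_subset[OF PQ(1) cd(1)] continuous_on_subset[OF PQ(2) cd(1)]] by blast
    define C where "C = \<bar>\<alpha>\<bar> + \<bar>\<beta>\<bar>"
    have bd: "\<forall>t\<in>{c..d}. \<bar>u n t\<bar> \<le> C / 2 ^ n * exp (2 * M * \<bar>t - t0\<bar>) \<and> \<bar>v n t\<bar> \<le> C / 2 ^ n * exp (2 * M * \<bar>t - t0\<bar>)" for n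
    proof (induction n)
      case 0
      have le: "C * 1 \<le> C * exp (2 * M * \<bar>t - t0\<bar>)" for t
        using M(1) by (intro mult_left_mono) (auto simp: C_def)
      have "\<bar>\<alpha>\<bar> \<le> C * exp (2 * M * \<bar>t - t0\<bar>) \<and> \<bar>\<beta>\<bar> \<le> C * exp (2 * M * \<bar>t - t0\<bar>)" for t
      proof -
        have "\<bar>\<alpha>\<bar> \<le> C" "\<bar>\<beta>\<bar> \<le> C" by (auto simp: C_def)
        with le[of t] show ?thesis by linarith
      qed
      then show ?case unfolding rec by simp
    next
      case (Suc n)
      have "\<bar>u (Suc n) t\<bar> \<le> C / 2 ^ n / 2 * exp (2 * M * \<bar>t - t0\<bar>) \<and>
          \<bar>v (Suc n) t\<bar> \<le> C / 2 ^ n / 2 * exp (2 * M * \<bar>t - t0\<bar>)" if "t \<in> {c..d}" for t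
      proof (rule picard_step_bound[where P = P and Q = Q and y = "u n" and z = "v n" and c = c and d = d])
        show "0 \<le> C / 2 ^ n" by (simp add: C_def)
        show "u (Suc n) t0 = 0" "v (Suc n) t0 = 0" unfolding rec using A(1) cont cont' by auto
        show "(u (Suc n) has_real_derivative v n t) (at t)"
          "(v (Suc n) has_real_derivative P t * v n t + Q t * u n t) (at t)" if "t \<in> {c..d}" for t
          using that cd(1) du[of t "Suc n"] dv[of t "Suc n"] by (auto simp: du_def dv_def)
      qed (use cd M Suc.IH that in auto)
      then show ?case by (simp add: mult.commute)
    qed
    define E where "E = C * exp (2 * M * (d - c))"
    have bd': "\<bar>u n x\<bar> \<le> E * (1/2) ^ n" "\<bar>v n x\<bar> \<le> E * (1/2) ^ n" if "x \<in> {c..d}" for n x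
    proof -
      have "C / 2 ^ n * exp (2 * M * \<bar>x - t0\<bar>) \<le> C / 2 ^ n * exp (2 * M * (d - c))"
        using that cd M(1) by (intro mult_left_mono) (auto simp: C_def)
      also have "\<dots> = E * (1/2) ^ n" by (simp add: E_def power_divide)
      finally show "\<bar>u n x\<bar> \<le> E * (1/2) ^ n" "\<bar>v n x\<bar> \<le> E * (1/2) ^ n"
        using bd[of n] that by force+
    qed
    have E: "E \<ge> 0" by (simp add: E_def C_def)
    have geo: "summable (\<lambda>n. E * (1/2) ^ n)" "summable (\<lambda>n. 2 * M * E * (1/2::real) ^ n)"
      by (intro summable_mult summable_geometric; simp)+
    have sum: "summable (\<lambda>n. u n x)" "summable (\<lambda>n. v n x)" if "x \<in> {c..d}" for x
      using bd'[OF that] by (auto intro!: summable_comparison_test'[OF geo(1)])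
    have ME: "E \<le> M * E" using E M(1) by (simp add: mult_le_cancel_right1)
    have "\<bar>du n x\<bar> \<le> 2 * M * E * (1/2) ^ n" "\<bar>dv n x\<bar> \<le> 2 * M * E * (1/2) ^ n" if "x \<in> {c..d}" for n x
    proof -
      show "\<bar>du n x\<bar> \<le> 2 * M * E * (1/2) ^ n"
      proof (cases n)
        case (Suc m)
        have "\<bar>v m x\<bar> \<le> E * (1/2) ^ m" by (rule bd'[OF that])
        also have "\<dots> \<le> M * E * (1/2) ^ m" using ME by (intro mult_right_mono) auto
        finally show ?thesis by (simp add: Suc du_def)
      qed (use E M in \<open>simp add: du_def\<close>)
      show "\<bar>dv n x\<bar> \<le> 2 * M * E * (1/2) ^ n"
      proof (cases n)
        case (Suc m)
        have "\<bar>P x * v m x + Q x * u m x\<bar> \<le> M * (E * (1/2) ^ m)" by (intro step_bound bd' M that)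
        then show ?thesis by (simp add: Suc dv_def)
      qed (use E M in \<open>simp add: dv_def\<close>)
    qed
    then have unif: "uniformly_convergent_on {c..d} (\<lambda>n x. \<Sum>i<n. du i x)"
      "uniformly_convergent_on {c..d} (\<lambda>n x. \<Sum>i<n. dv i x)"
      by (auto intro!: Weierstrass_m_test'[OF _ geo(2)])
    have t': "t \<in> {c..d}" "t \<in> interior {c..d}" using cd by auto
    have D: "((\<lambda>t. \<Sum>n. u n t) has_real_derivative (\<Sum>n. du n t)) (at t)"
      "((\<lambda>t. \<Sum>n. v n t) has_real_derivative (\<Sum>n. dv n t)) (at t)"
    proof -
      have *: "(u n has_real_derivative du n x) (at x within {c..d})"
        "(v n has_real_derivative dv n x) (at x within {c..d})" if "x \<in> {c..d}" for n x
        by (rule has_field_derivative_at_within[OF du[OF subsetD[OF cd(1) that]]]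
            has_field_derivative_at_within[OF dv[OF subsetD[OF cd(1) that]]])+
      show "((\<lambda>t. \<Sum>n. u n t) has_real_derivative (\<Sum>n. du n t)) (at t)"
        by (rule has_field_derivative_series'(2)[where S = "{c..d}"])
          (fact convex_real_interval(5) *(1) unif(1) t' sum(1)[OF t'(1)])+
      show "((\<lambda>t. \<Sum>n. v n t) has_real_derivative (\<Sum>n. dv n t)) (at t)"
        by (rule has_field_derivative_series'(2)[where S = "{c..d}"])
          (fact convex_real_interval(5) *(2) unif(2) t' sum(2)[OF t'(1)])+
    qed
    have "(\<lambda>n. v n t) sums (\<Sum>n. v n t)" using sum t' by blast
    then have "(\<lambda>n. du n t) sums (\<Sum>n. v n t)"
      using sums_Suc[of "\<lambda>n. du n t"] by (simp add: du_def)
    moreover have "(\<lambda>n. P t * v n t + Q t * u n t) sums (P t * (\<Sum>n. v n t) + Q t * (\<Sum>n. u n t))"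
      using sum t' by (intro sums_add sums_mult) blast+
    then have "(\<lambda>n. dv n t) sums (P t * (\<Sum>n. v n t) + Q t * (\<Sum>n. u n t))"
      using sums_Suc[of "\<lambda>n. dv n t"] by (simp add: dv_def)
    ultimately show ?thesis using D by (simp only: sums_iff)
  qed
  have "u n t0 = (if n = 0 then \<alpha> else 0)" "v n t0 = (if n = 0 then \<beta> else 0)" for n
    using A(1)[OF cont'] A(1) cont by (cases n; simp add: rec)+
  then have "(\<Sum>n. u n t0) = \<alpha>" "(\<Sum>n. v n t0) = \<beta>"
    using sums_unique[OF sums_single[of 0 "\<lambda>_. \<alpha>"]] sums_unique[OF sums_single[of 0 "\<lambda>_. \<beta>"]] by simp_all
  with main show ?thesis
    by (intro exI[of _ "\<lambda>t. \<Sum>n. u n t"] exI[of _ "\<lambda>t. \<Sum>n. v n t"]) simp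
qed

section \<open>Initial value problems and the 4-dimensional family\<close>

lemma hg_intervalD:
  assumes "hg_interval J"
  shows "open J" "is_interval J" "0 \<notin> J" "1 \<notin> J"
  using assms by (auto simp: hg_interval_def)

text \<open>A solution can be given together with any function that agrees with its derivative on \<open>J\<close>.\<close>

lemma hg_solutionI:
  assumes J: "open J" "0 \<notin> J" "1 \<notin> J"
    and y: "\<And>s. s \<in> J \<Longrightarrow> (y has_real_derivative z s) (at s)"
    and z: "\<And>s. s \<in> J \<Longrightarrow> (z has_real_derivative hg_P T s * z s + hg_Q T s * y s) (at s)"
  shows "hg_solution T J y" "\<And>s. s \<in> J \<Longrightarrow> deriv y s = z s"
proof -
  show eq: "deriv y s = z s" if "s \<in> J" for s
    using y[OF that] by (rule DERIV_imp_deriv)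
  have "(deriv y has_real_derivative hg_P T s * deriv y s + hg_Q T s * y s) (at s)" if "s \<in> J" for s
    using z[OF that] has_field_derivative_transform_within_open[OF _ J(1) that] eq that by force
  with y eq show "hg_solution T J y"
    unfolding hg_solution_iff[OF J(2,3)] by simp
qed

lemma hg_solutionD:
  assumes "hg_solution T J w" "0 \<notin> J" "1 \<notin> J" "s \<in> J"
  shows "(w has_real_derivative deriv w s) (at s)"
    "(deriv w has_real_derivative hg_P T s * deriv w s + hg_Q T s * w s) (at s)"
  using assms hg_solution_iff by auto

lemma hg_solution_cong:
  assumes J: "open J" "0 \<notin> J" "1 \<notin> J" and eq: "\<And>s. s \<in> J \<Longrightarrow> u s = v s"
  shows "hg_solution T J u \<longleftrightarrow> hg_solution T J v"
proof -
  have *: "hg_solution T J v" if eq: "\<And>s. s \<in> J \<Longrightarrow> u s = v s" and u: "hg_solution T J u" for u v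
  proof (rule hg_solutionI(1)[OF J, where z = "deriv u"])
    fix s assume s: "s \<in> J"
    show "(v has_real_derivative deriv u s) (at s)"
      using has_field_derivative_transform_within_open[OF hg_solutionD(1)[OF u J(2,3) s] J(1) s eq] .
    show "(deriv u has_real_derivative hg_P T s * deriv u s + hg_Q T s * v s) (at s)"
      using hg_solutionD(2)[OF u J(2,3) s] eq[OF s] by simp
  qed
  show ?thesis using *[of u v] *[of v u] eq by auto
qed

lemma continuous_on_hg_coeff:
  assumes "0 \<notin> J" "1 \<notin> J"
  shows "continuous_on J (hg_P T)" "continuous_on J (hg_Q T)"
  unfolding hg_P_def[abs_def] hg_Q_def[abs_def] using assms
  by (cases T; auto intro!: continuous_intros)+

lemma hg_ivp_exists:
  assumes J: "open J" "is_interval J" "0 \<notin> J" "1 \<notin> J" and "t0 \<in> J"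
  obtains w where "hg_solution T J w" "w t0 = \<alpha>" "deriv w t0 = \<beta>"
proof -
  obtain y z where yz: "\<forall>t\<in>J. (y has_real_derivative z t) (at t)"
    "\<forall>t\<in>J. (z has_real_derivative hg_P T t * z t + hg_Q T t * y t) (at t)" "y t0 = \<alpha>" "z t0 = \<beta>"
    using linear_ode_exists[OF J(1,2) \<open>t0 \<in> J\<close> continuous_on_hg_coeff[OF J(3,4)]] by metis
  then show thesis
    using hg_solutionI[OF J(1,3,4), of y z T] \<open>t0 \<in> J\<close> by (intro that[of y]) auto
qed

lemma hg_unique:
  assumes J: "open J" "is_interval J" "0 \<notin> J" "1 \<notin> J" and "t0 \<in> J"
    and w: "hg_solution T J w" "w t0 = 0" "deriv w t0 = 0" and "s \<in> J"
  shows "w s = 0"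
  using linear_ode_unique[OF J(1,2) \<open>t0 \<in> J\<close> continuous_on_hg_coeff[OF J(3,4)]
    hg_solutionD[OF w(1) J(3,4)] w(2,3) \<open>s \<in> J\<close>] by blast

lemma hg_solution_combination:
  assumes J: "open J" "0 \<notin> J" "1 \<notin> J" and u: "hg_solution T J u" and v: "hg_solution T J v"
  shows "hg_solution T J (\<lambda>s. \<alpha> * u s + \<beta> * v s)"
    "\<And>s. s \<in> J \<Longrightarrow> deriv (\<lambda>s. \<alpha> * u s + \<beta> * v s) s = \<alpha> * deriv u s + \<beta> * deriv v s"
proof -
  have 1: "((\<lambda>s. \<alpha> * u s + \<beta> * v s) has_real_derivative \<alpha> * deriv u s + \<beta> * deriv v s) (at s)"
    and 2: "((\<lambda>s. \<alpha> * deriv u s + \<beta> * deriv v s) has_real_derivative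
      hg_P T s * (\<alpha> * deriv u s + \<beta> * deriv v s) + hg_Q T s * (\<alpha> * u s + \<beta> * v s)) (at s)" if "s \<in> J" for s
    using hg_solutionD[OF u J(2,3) that] hg_solutionD[OF v J(2,3) that]
    by (auto intro!: derivative_eq_intros simp: algebra_simps)
  show "hg_solution T J (\<lambda>s. \<alpha> * u s + \<beta> * v s)"
    "\<And>s. s \<in> J \<Longrightarrow> deriv (\<lambda>s. \<alpha> * u s + \<beta> * v s) s = \<alpha> * deriv u s + \<beta> * deriv v s"
    using hg_solutionI[OF J 1 2] by auto
qed

text \<open>The parameters are the initial values \<open>(u, u', v, v')\<close> of the pair at a point \<open>t0\<close>, and \<open>y1, y2\<close> is the basis
of solutions with initial values \<open>(1, 0)\<close> and \<open>(0, 1)\<close>.\<close>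

lemma four_dim_family_hg_pairs:
  assumes J: "hg_interval J"
  shows "four_dim_family J (hg_pairs T J)"
proof -
  note J' = hg_intervalD[OF J]
  obtain t0 where t0: "t0 \<in> J" using J by (auto simp: hg_interval_def)
  obtain y1 where y1: "hg_solution T J y1" "y1 t0 = 1" "deriv y1 t0 = 0"
    using hg_ivp_exists[OF J' t0] .
  obtain y2 where y2: "hg_solution T J y2" "y2 t0 = 0" "deriv y2 t0 = 1"
    using hg_ivp_exists[OF J' t0] .
  define \<Phi> where "\<Phi> t s = t $ 1 * y1 s + t $ 2 * y2 s" for t :: "real^4" and s
  define \<Psi> where "\<Psi> t s = t $ 3 * y1 s + t $ 4 * y2 s" for t :: "real^4" and s
  define U where "U = {t :: real^4. t $ 1 * t $ 4 - t $ 2 * t $ 3 \<noteq> 0}"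
  note comb = hg_solution_combination[OF J'(1,3,4)]
  have \<Phi>: "hg_solution T J (\<Phi> t)" "\<Phi> t t0 = t $ 1" "deriv (\<Phi> t) t0 = t $ 2" for t
    unfolding \<Phi>_def[abs_def] using comb(1)[OF y1(1) y2(1), of "t $ 1" "t $ 2"] comb(2)[OF y1(1) y2(1) t0, of "t $ 1" "t $ 2"] y1 y2 t0 by auto
  have \<Psi>: "hg_solution T J (\<Psi> t)" "\<Psi> t t0 = t $ 3" "deriv (\<Psi> t) t0 = t $ 4" for t
    unfolding \<Psi>_def[abs_def] using comb(1)[OF y1(1) y2(1), of "t $ 3" "t $ 4"] comb(2)[OF y1(1) y2(1) t0, of "t $ 3" "t $ 4"] y1 y2 t0 by auto
  have zero_iff: "(\<forall>s\<in>J. w s = 0) \<longleftrightarrow> w t0 = 0 \<and> deriv w t0 = 0" if "hg_solution T J w" for w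
  proof
    assume 0: "\<forall>s\<in>J. w s = 0"
    then have "((\<lambda>_. 0) has_real_derivative deriv w t0) (at t0)"
      using has_field_derivative_transform_within_open[OF hg_solutionD(1)[OF that J'(3,4) t0] J'(1) t0] by simp
    then have "deriv w t0 = 0" using DERIV_const DERIV_unique by blast
    with 0 t0 show "w t0 = 0 \<and> deriv w t0 = 0" by blast
  qed (use hg_unique[OF J' t0 that] in blast)
  have eq_iff: "(\<forall>s\<in>J. u s = v s) \<longleftrightarrow> u t0 = v t0 \<and> deriv u t0 = deriv v t0"
    if "hg_solution T J u" "hg_solution T J v" for u v
    using zero_iff[OF comb(1)[OF that, of 1 "-1"]] comb(2)[OF that t0, of 1 "-1"] by simp
  have indep_iff: "lin_indep_on J u v \<longleftrightarrow> u t0 * deriv v t0 - deriv u t0 * v t0 \<noteq> 0"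
    if uv: "hg_solution T J u" "hg_solution T J v" for u v
  proof -
    let ?a = "u t0" and ?b = "deriv u t0" and ?c = "v t0" and ?d = "deriv v t0"
    have "lin_indep_on J u v \<longleftrightarrow>
        (\<forall>\<alpha> \<beta>. \<alpha> * ?a + \<beta> * ?c = 0 \<and> \<alpha> * ?b + \<beta> * ?d = 0 \<longrightarrow> \<alpha> = 0 \<and> \<beta> = 0)"
      unfolding lin_indep_on_def zero_iff[OF comb(1)[OF uv]] comb(2)[OF uv t0] ..
    also have "\<dots> \<longleftrightarrow> ?a * ?d - ?b * ?c \<noteq> 0"
    proof (intro iffI allI impI notI)
      assume ind: "\<forall>\<alpha> \<beta>. \<alpha> * ?a + \<beta> * ?c = 0 \<and> \<alpha> * ?b + \<beta> * ?d = 0 \<longrightarrow> \<alpha> = 0 \<and> \<beta> = 0"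
        and det: "?a * ?d - ?b * ?c = 0"
      \<comment> \<open>If the determinant vanishes, the coefficients \<open>(v t0, - u t0)\<close> and \<open>(v' t0, - u' t0)\<close> give linear relations between \<open>u\<close> and \<open>v\<close>.\<close>
      have "?c = 0 \<and> - ?a = 0" using ind[rule_format, of "?c" "- ?a"] det by (simp add: algebra_simps)
      moreover have "?d = 0 \<and> - ?b = 0" using ind[rule_format, of "?d" "- ?b"] det by (simp add: algebra_simps)
      ultimately show False using ind[rule_format, of 1 0] by simp
    next
      fix \<alpha> \<beta> assume det: "?a * ?d - ?b * ?c \<noteq> 0" and 0: "\<alpha> * ?a + \<beta> * ?c = 0 \<and> \<alpha> * ?b + \<beta> * ?d = 0"
      have "\<alpha> * (?a * ?d - ?b * ?c) = (\<alpha> * ?a + \<beta> * ?c) * ?d - (\<alpha> * ?b + \<beta> * ?d) * ?c"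
        "\<beta> * (?a * ?d - ?b * ?c) = (\<alpha> * ?b + \<beta> * ?d) * ?a - (\<alpha> * ?a + \<beta> * ?c) * ?b"
        by (simp_all add: algebra_simps)
      then have "\<alpha> * (?a * ?d - ?b * ?c) = 0" "\<beta> * (?a * ?d - ?b * ?c) = 0"
        unfolding conjunct1[OF 0] conjunct2[OF 0] by simp_all
      with det show "\<alpha> = 0 \<and> \<beta> = 0" by (metis mult_eq_0_iff)
    qed
    finally show ?thesis .
  qed
  have "open U"
    unfolding U_def by (intro open_Collect_neq continuous_intros)
  moreover have "(\<chi> i. if i = 1 \<or> i = 4 then 1 else 0) \<in> U"
    by (simp add: U_def)
  then have "U \<noteq> {}" by blast
  moreover have "\<forall>s\<in>J. linear (\<lambda>t. \<Phi> t s) \<and> linear (\<lambda>t. \<Psi> t s)"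
    by (auto simp: \<Phi>_def \<Psi>_def intro!: linearI simp: algebra_simps)
  moreover have "\<forall>t\<in>U. (\<Phi> t, \<Psi> t) \<in> hg_pairs T J"
    using \<Phi> \<Psi> indep_iff by (auto simp: hg_pairs_def U_def)
  moreover have "\<forall>(u, v)\<in>hg_pairs T J. \<exists>!t. t \<in> U \<and> (\<forall>s\<in>J. u s = \<Phi> t s \<and> v s = \<Psi> t s)"
  proof (clarify)
    fix u v assume "(u, v) \<in> hg_pairs T J"
    then have uv: "hg_solution T J u" "hg_solution T J v" "lin_indep_on J u v" by (auto simp: hg_pairs_def)
    have iff: "(\<forall>s\<in>J. u s = \<Phi> t s \<and> v s = \<Psi> t s) \<longleftrightarrow>
        t $ 1 = u t0 \<and> t $ 2 = deriv u t0 \<and> t $ 3 = v t0 \<and> t $ 4 = deriv v t0" for t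
      unfolding ball_conj_distrib eq_iff[OF uv(1) \<Phi>(1)] eq_iff[OF uv(2) \<Psi>(1)] \<Phi> \<Psi> by auto
    define t :: "real^4" where "t = (\<chi> i. if i = 1 then u t0 else if i = 2 then deriv u t0 else if i = 3 then v t0 else deriv v t0)"
    have t: "t $ 1 = u t0" "t $ 2 = deriv u t0" "t $ 3 = v t0" "t $ 4 = deriv v t0" by (simp_all add: t_def)
    show "\<exists>!t. t \<in> U \<and> (\<forall>s\<in>J. u s = \<Phi> t s \<and> v s = \<Psi> t s)"
      unfolding iff
    proof (rule ex1I[of _ t])
      show "t \<in> U \<and> t $ 1 = u t0 \<and> t $ 2 = deriv u t0 \<and> t $ 3 = v t0 \<and> t $ 4 = deriv v t0"
        using indep_iff[OF uv(1,2)] uv(3) by (simp add: t U_def)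
    qed (use t in \<open>simp add: vec_eq_iff forall_4\<close>)
  qed
  ultimately show ?thesis unfolding four_dim_family_def by blast
qed

section \<open>Equivalence of hypergeometric equations\<close>

text \<open>The images of \<open>0, 1, \<infinity>\<close> determine the matrix up to a factor, and they form a permutation because the
determinant does not vanish.\<close>

lemma six_substitutions:
  assumes "permutes_singular_points \<alpha> \<beta> \<gamma> \<delta>"
  obtains (id) "\<And>s. s \<noteq> 0 \<Longrightarrow> s \<noteq> 1 \<Longrightarrow> (\<alpha> * s + \<beta>) / (\<gamma> * s + \<delta>) = s"
    | (flip) "\<And>s. s \<noteq> 0 \<Longrightarrow> s \<noteq> 1 \<Longrightarrow> (\<alpha> * s + \<beta>) / (\<gamma> * s + \<delta>) = 1 - s"
    | (inv) "\<And>s. s \<noteq> 0 \<Longrightarrow> s \<noteq> 1 \<Longrightarrow> (\<alpha> * s + \<beta>) / (\<gamma> * s + \<delta>) = 1 / s"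
    | (flip_inv) "\<And>s. s \<noteq> 0 \<Longrightarrow> s \<noteq> 1 \<Longrightarrow> (\<alpha> * s + \<beta>) / (\<gamma> * s + \<delta>) = 1 - 1 / s"
    | (pfaff) "\<And>s. s \<noteq> 0 \<Longrightarrow> s \<noteq> 1 \<Longrightarrow> (\<alpha> * s + \<beta>) / (\<gamma> * s + \<delta>) = 1 - 1 / (1 - s)"
    | (inv_flip) "\<And>s. s \<noteq> 0 \<Longrightarrow> s \<noteq> 1 \<Longrightarrow> (\<alpha> * s + \<beta>) / (\<gamma> * s + \<delta>) = 1 / (1 - s)"
proof -
  have det: "\<alpha> * \<delta> - \<beta> * \<gamma> \<noteq> 0"
    and m: "\<beta> = 0 \<or> \<delta> = 0 \<or> \<beta> = \<delta>" "\<alpha> = - \<beta> \<or> \<gamma> = - \<delta> \<or> \<alpha> + \<beta> = \<gamma> + \<delta>" "\<alpha> = 0 \<or> \<gamma> = 0 \<or> \<alpha> = \<gamma>"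
    using assms by (auto simp: permutes_singular_points_def marked_point_def eq_neg_iff_add_eq_0)
  have cases: "\<beta> = 0 \<and> \<gamma> = 0 \<and> \<alpha> = \<delta> \<and> \<delta> \<noteq> 0 \<or> \<gamma> = 0 \<and> \<beta> = \<delta> \<and> \<alpha> = - \<delta> \<and> \<delta> \<noteq> 0
      \<or> \<alpha> = 0 \<and> \<delta> = 0 \<and> \<beta> = \<gamma> \<and> \<gamma> \<noteq> 0 \<or> \<delta> = 0 \<and> \<alpha> = \<gamma> \<and> \<beta> = - \<gamma> \<and> \<gamma> \<noteq> 0
      \<or> \<beta> = 0 \<and> \<alpha> = \<gamma> \<and> \<delta> = - \<gamma> \<and> \<gamma> \<noteq> 0 \<or> \<alpha> = 0 \<and> \<beta> = \<delta> \<and> \<gamma> = - \<delta> \<and> \<delta> \<noteq> 0"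
    using m det by (elim disjE) auto
  have q: "(\<gamma> * s + - \<gamma>) = \<gamma> * (s - 1)" "(- \<delta> * s + \<delta>) = \<delta> * (1 - s)" for s by (simp_all add: algebra_simps)
  from cases show thesis
  proof (elim disjE conjE)
    assume "\<beta> = 0" "\<gamma> = 0" "\<alpha> = \<delta>" "\<delta> \<noteq> 0" then show thesis by (intro id) simp
  next
    assume "\<gamma> = 0" "\<beta> = \<delta>" "\<alpha> = - \<delta>" "\<delta> \<noteq> 0" then show thesis by (intro flip) (simp add: field_simps)
  next
    assume "\<alpha> = 0" "\<delta> = 0" "\<beta> = \<gamma>" "\<gamma> \<noteq> 0" then show thesis by (intro inv) (simp add: field_simps)
  next
    assume "\<delta> = 0" "\<alpha> = \<gamma>" "\<beta> = - \<gamma>" "\<gamma> \<noteq> 0" then show thesis by (intro flip_inv) (simp add: field_simps)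
  next
    assume *: "\<beta> = 0" "\<alpha> = \<gamma>" "\<delta> = - \<gamma>" "\<gamma> \<noteq> 0"
    show thesis by (rule pfaff) (use *(4) in \<open>simp add: *(1-3) q(1) divide_simps; simp add: algebra_simps\<close>)
  next
    assume *: "\<alpha> = 0" "\<beta> = \<delta>" "\<gamma> = - \<delta>" "\<delta> \<noteq> 0"
    show thesis by (rule inv_flip) (use *(4) in \<open>simp add: *(1-3) q(2) divide_simps; simp add: algebra_simps\<close>)
  qed
qed

text \<open>Writing \<open>\<bar>u\<bar>\<^sup>e\<close> as \<open>(u\<^sup>2)\<^sup>e\<^sup>/\<^sup>2\<close> makes the base positive for either sign of \<open>u\<close>.\<close>

lemma DERIV_abs_powr:
  assumes "(u has_real_derivative u') (at s)" "u s \<noteq> 0"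
  shows "((\<lambda>s. \<bar>u s\<bar> powr e) has_real_derivative e * u' / u s * \<bar>u s\<bar> powr e) (at s)"
proof -
  have eq: "\<bar>x\<bar> powr e = (x * x) powr (e / 2)" for x :: real
  proof -
    have "(x * x) powr (e / 2) = (\<bar>x\<bar> * \<bar>x\<bar>) powr (e / 2)" by simp
    also have "\<dots> = \<bar>x\<bar> powr (e / 2) * \<bar>x\<bar> powr (e / 2)" by (rule powr_mult)
    also have "\<dots> = \<bar>x\<bar> powr (e / 2 + e / 2)" by (rule powr_add[symmetric])
    finally show ?thesis by simp
  qed
  have "((\<lambda>s. (u s * u s) powr (e / 2)) has_real_derivative
      e / 2 * (u s * u s) powr (e / 2 - 1) * (u' * u s + u' * u s)) (at s)"
    using assms by (intro DERIV_chain2[OF has_real_derivative_powr] DERIV_mult) (auto simp: zero_less_mult_iff)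
  moreover have "e / 2 * (u s * u s) powr (e / 2 - 1) * (u' * u s + u' * u s) = e * u' / u s * (u s * u s) powr (e / 2)"
    using assms(2) by (simp only: powr_diff powr_one_gt_zero_iff) (simp add: field_simps)
  ultimately show ?thesis unfolding eq by (rule DERIV_cong)
qed

lemma quadratic_zero_on_open:
  fixes k0 k1 k2 :: real
  assumes "open J" "J \<noteq> {}" "\<And>s. s \<in> J \<Longrightarrow> k0 + k1 * s + k2 * s\<^sup>2 = 0"
  shows "k0 = 0" "k1 = 0" "k2 = 0"
proof -
  let ?p = "[:k0, k1, k2:]"
  have "infinite J"
    using assms(1,2) by (meson finite_imp_not_open)
  moreover have "J \<subseteq> {s. poly ?p s = 0}"
    using assms(3) by (auto simp: power2_eq_square algebra_simps)
  ultimately have "infinite {s. poly ?p s = 0}" using finite_subset by blast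
  then have "?p = 0" using poly_roots_finite by blast
  then show "k0 = 0" "k1 = 0" "k2 = 0" by auto
qed

text \<open>The solution is extended by zero to the other two components, so that its domain contains every image
\<open>\<psi> ` J\<close>, whatever component that lies in.\<close>

lemma hg_solution_initial:
  assumes x0: "x0 \<noteq> 0" "x0 \<noteq> 1"
  obtains w where "hg_solution T (UNIV - {0, 1}) w" "w x0 = \<alpha>" "deriv w x0 = \<beta>"
proof -
  consider "x0 < 0" | "0 < x0" "x0 < 1" | "1 < x0" using x0 by linarith
  then have "\<exists>C D. open C \<and> is_interval C \<and> 0 \<notin> C \<and> 1 \<notin> C \<and> x0 \<in> C \<and> open D \<and>
      UNIV - {0, 1} \<subseteq> C \<union> D \<and> C \<inter> D = {}"
  proof cases
    case 1
    then show ?thesis by (intro exI[of _ "{..<0}"] exI[of _ "{0<..}"]) (auto simp: is_interval_1)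
  next
    case 2
    then show ?thesis by (intro exI[of _ "{0<..<1}"] exI[of _ "{..<0} \<union> {1<..}"]) (auto simp: is_interval_1)
  next
    case 3
    then show ?thesis by (intro exI[of _ "{1<..}"] exI[of _ "{..<1}"]) (auto simp: is_interval_1)
  qed
  then obtain C D where C: "open C" "is_interval C" "0 \<notin> C" "1 \<notin> C" "x0 \<in> C"
    and D: "open D" "UNIV - {0, 1} \<subseteq> C \<union> D" "C \<inter> D = {}" by blast
  obtain w where w: "hg_solution T C w" "w x0 = \<alpha>" "deriv w x0 = \<beta>"
    using hg_ivp_exists[OF C(1-5)] .
  define y where "y s = (if s \<in> C then w s else 0)" for s
  define z where "z s = (if s \<in> C then deriv w s else 0)" for s
  have "(y has_real_derivative z s) (at s) \<and> (z has_real_derivative hg_P T s * z s + hg_Q T s * y s) (at s)"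
    if s: "s \<in> UNIV - {0, 1}" for s
  proof (cases "s \<in> C")
    case True
    have "(y has_real_derivative deriv w s) (at s)"
      by (rule has_field_derivative_transform_within_open[OF hg_solutionD(1)[OF w(1) C(3,4) True] C(1) True])
        (simp add: y_def)
    moreover have "(z has_real_derivative hg_P T s * deriv w s + hg_Q T s * w s) (at s)"
      by (rule has_field_derivative_transform_within_open[OF hg_solutionD(2)[OF w(1) C(3,4) True] C(1) True])
        (simp add: z_def)
    ultimately show ?thesis using True by (simp add: y_def z_def)
  next
    case False
    then have s': "s \<in> D" using s D by blast
    have off: "r \<notin> C" if "r \<in> D" for r using D that by blast
    have "(y has_real_derivative 0) (at s)"
      by (rule has_field_derivative_transform_within_open[OF DERIV_const D(1) s']) (simp add: y_def off)
    moreover have "(z has_real_derivative 0) (at s)"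
      by (rule has_field_derivative_transform_within_open[OF DERIV_const D(1) s']) (simp add: z_def off)
    ultimately show ?thesis using False by (simp add: y_def z_def)
  qed
  then have *: "\<And>s. s \<in> UNIV - {0, 1} \<Longrightarrow> (y has_real_derivative z s) (at s)"
    "\<And>s. s \<in> UNIV - {0, 1} \<Longrightarrow> (z has_real_derivative hg_P T s * z s + hg_Q T s * y s) (at s)" by blast+
  have "open (UNIV - {0, 1 :: real})" by (intro open_Diff) auto
  then have "hg_solution T (UNIV - {0, 1}) y" "deriv y x0 = z x0"
    using hg_solutionI(1)[of "UNIV - {0, 1}" y z T, OF _ _ _ *]
      hg_solutionI(2)[of "UNIV - {0, 1}" y z T x0, OF _ _ _ *] x0 by blast+
  moreover have "y x0 = \<alpha>" "z x0 = \<beta>" using w C by (simp_all add: y_def z_def)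
  ultimately show thesis using that by simp
qed

text \<open>If \<open>w'' = P w' + Q w\<close>, then \<open>m (w \<circ> \<psi>)\<close> and its first two derivatives are combinations of \<open>w\<close> and \<open>w'\<close> at \<open>\<psi> s\<close>, with
\<open>\<kappa> = m' / m\<close>. Since the values of \<open>w\<close> and \<open>w'\<close> at \<open>\<psi> s\<close> are arbitrary, their coefficients in the second equation
vanish separately.\<close>

lemma hg_transported_coefficients:
  assumes J: "open J" "0 \<notin> J" "1 \<notin> J" and s: "s \<in> J"
    and \<psi>: "\<And>s. s \<in> J \<Longrightarrow> (\<psi> has_real_derivative \<psi>' s) (at s)" "(\<psi>' has_real_derivative \<psi>'') (at s)"
      "\<And>s. s \<in> J \<Longrightarrow> \<psi> s \<noteq> 0 \<and> \<psi> s \<noteq> 1"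
    and m: "\<And>s. s \<in> J \<Longrightarrow> (m has_real_derivative \<kappa> s * m s) (at s)" "(\<kappa> has_real_derivative \<kappa>1) (at s)" "m s \<noteq> 0"
    and rel: "\<And>w. hg_solution T (\<psi> ` J) w \<Longrightarrow> hg_solution T' J (\<lambda>s. m s * w (\<psi> s))"
  shows "2 * \<kappa> s * \<psi>' s + \<psi>'' + hg_P T (\<psi> s) * (\<psi>' s)\<^sup>2 = hg_P T' s * \<psi>' s"
    "(\<kappa> s)\<^sup>2 + \<kappa>1 + hg_Q T (\<psi> s) * (\<psi>' s)\<^sup>2 = hg_P T' s * \<kappa> s + hg_Q T' s"
proof -
  have *: "(2 * \<kappa> s * \<psi>' s + \<psi>'' + hg_P T (\<psi> s) * (\<psi>' s)\<^sup>2 - hg_P T' s * \<psi>' s) * b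
      + ((\<kappa> s)\<^sup>2 + \<kappa>1 + hg_Q T (\<psi> s) * (\<psi>' s)\<^sup>2 - (hg_P T' s * \<kappa> s + hg_Q T' s)) * a = 0" for a b
  proof -
    obtain w where w: "hg_solution T (UNIV - {0, 1}) w" "w (\<psi> s) = a" "deriv w (\<psi> s) = b"
      using hg_solution_initial \<psi>(3)[OF s] by metis
    have dw: "(w has_real_derivative deriv w (\<psi> s)) (at (\<psi> s))"
      "(deriv w has_real_derivative hg_P T (\<psi> s) * deriv w (\<psi> s) + hg_Q T (\<psi> s) * w (\<psi> s)) (at (\<psi> s))"
      if "s \<in> J" for s
      using hg_solutionD[OF w(1)] \<psi>(3)[OF that] by auto
    have "hg_solution T (\<psi> ` J) w"
      using w(1) \<psi>(3) unfolding hg_solution_def by force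
    then have W: "hg_solution T' J (\<lambda>s. m s * w (\<psi> s))" by (rule rel)
    let ?W = "\<lambda>s. m s * w (\<psi> s)"
    have W1: "deriv ?W s = m s * (\<kappa> s * w (\<psi> s) + \<psi>' s * deriv w (\<psi> s))" if "s \<in> J" for s
    proof (rule DERIV_imp_deriv)
      show "(?W has_real_derivative m s * (\<kappa> s * w (\<psi> s) + \<psi>' s * deriv w (\<psi> s))) (at s)"
        by (rule derivative_eq_intros m(1)[OF that] DERIV_chain2[OF dw(1)[OF that] \<psi>(1)[OF that]] refl)+
          (simp add: algebra_simps)
    qed
    have "((\<lambda>s. m s * (\<kappa> s * w (\<psi> s) + \<psi>' s * deriv w (\<psi> s))) has_real_derivative
        m s * (((\<kappa> s)\<^sup>2 + \<kappa>1) * a + (2 * \<kappa> s * \<psi>' s + \<psi>'') * b + (\<psi>' s)\<^sup>2 * (hg_P T (\<psi> s) * b + hg_Q T (\<psi> s) * a))) (at s)"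
      by (rule derivative_eq_intros m(1)[OF s] m(2) \<psi>(2) DERIV_chain2[OF dw(1)[OF s] \<psi>(1)[OF s]]
          DERIV_chain2[OF dw(2)[OF s] \<psi>(1)[OF s]] refl)+
        (simp add: w algebra_simps power2_eq_square)
    then have "(deriv ?W has_real_derivative
        m s * (((\<kappa> s)\<^sup>2 + \<kappa>1) * a + (2 * \<kappa> s * \<psi>' s + \<psi>'') * b + (\<psi>' s)\<^sup>2 * (hg_P T (\<psi> s) * b + hg_Q T (\<psi> s) * a))) (at s)"
      by (rule has_field_derivative_transform_within_open[OF _ J(1) s]) (simp add: W1)
    from DERIV_unique[OF this hg_solutionD(2)[OF W J(2,3) s]]
    have "m s * (((\<kappa> s)\<^sup>2 + \<kappa>1) * a + (2 * \<kappa> s * \<psi>' s + \<psi>'') * b + (\<psi>' s)\<^sup>2 * (hg_P T (\<psi> s) * b + hg_Q T (\<psi> s) * a))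
      = m s * (hg_P T' s * (\<kappa> s * a + \<psi>' s * b) + hg_Q T' s * a)"
      unfolding W1[OF s] by (simp add: w algebra_simps)
    then have "((\<kappa> s)\<^sup>2 + \<kappa>1) * a + (2 * \<kappa> s * \<psi>' s + \<psi>'') * b + (\<psi>' s)\<^sup>2 * (hg_P T (\<psi> s) * b + hg_Q T (\<psi> s) * a)
      = hg_P T' s * (\<kappa> s * a + \<psi>' s * b) + hg_Q T' s * a"
      using m(3) by (simp only: mult_cancel_left) simp
    then show ?thesis by (simp add: algebra_simps)
  qed
  show "2 * \<kappa> s * \<psi>' s + \<psi>'' + hg_P T (\<psi> s) * (\<psi>' s)\<^sup>2 = hg_P T' s * \<psi>' s"
    using *[where a = 0 and b = 1] by simp
  show "(\<kappa> s)\<^sup>2 + \<kappa>1 + hg_Q T (\<psi> s) * (\<psi>' s)\<^sup>2 = hg_P T' s * \<kappa> s + hg_Q T' s"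
    using *[where a = 1 and b = 0] by simp
qed

text \<open>Multiplied by \<open>s (1 - s)\<close> and \<open>s\<^sup>2 (1 - s)\<^sup>2\<close>, the two coefficient identities are polynomial identities of
degree at most 2. The values of the second one at \<open>s = 0\<close> and \<open>s = 1\<close> and its leading coefficient are the indicial equations at
\<open>0, 1, \<infinity>\<close>: \<open>e\<close>, \<open>f\<close> and \<open>- e - f\<close> shift the exponents there. The constants \<open>r0, r1\<close> and \<open>k0, k1, k2\<close> are those of the
equation in the variable \<open>s\<close> that arises from the first one by the substitution \<open>\<psi>\<close>.\<close>

lemma hg_exponent_equations:
  fixes e f :: real
  assumes J: "open J" "0 \<notin> J" "1 \<notin> J" "J \<noteq> {}"
    and \<psi>: "\<And>s. s \<in> J \<Longrightarrow> (\<psi> has_real_derivative \<psi>' s) (at s)"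
      "\<And>s. s \<in> J \<Longrightarrow> (\<psi>' has_real_derivative \<psi>'' s) (at s)"
      "\<And>s. s \<in> J \<Longrightarrow> \<psi> s \<noteq> 0 \<and> \<psi> s \<noteq> 1" "\<And>s. s \<in> J \<Longrightarrow> \<psi>' s \<noteq> 0"
    and rel: "\<And>w. hg_solution T (\<psi> ` J) w \<Longrightarrow>
        hg_solution (a', b', c') J (\<lambda>s. \<bar>s\<bar> powr e * \<bar>1 - s\<bar> powr f * w (\<psi> s))"
    and r: "\<And>s. s \<in> J \<Longrightarrow> \<psi>'' s + hg_P T (\<psi> s) * (\<psi>' s)\<^sup>2 = (r0 / s + r1 / (1 - s)) * \<psi>' s"
    and k: "\<And>s. s \<in> J \<Longrightarrow> hg_Q T (\<psi> s) * (\<psi>' s)\<^sup>2 =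
        k2 / (s * (1 - s)) - k0 / (s\<^sup>2 * (1 - s)) - k1 / (s * (1 - s)\<^sup>2)"
  shows "e = - (r0 + c') / 2" "f = (r1 - (a' + b' + 1 - c')) / 2"
    "e * (e - 1) + c' * e = k0" "f * (f - 1) + (a' + b' + 1 - c') * f = k1"
    "(e + f + a') * (e + f + b') = k2"
proof -
  define m where "m s = \<bar>s\<bar> powr e * \<bar>1 - s\<bar> powr f" for s :: real
  define \<kappa> where "\<kappa> s = e / s - f / (1 - s)" for s
  have nz: "s \<noteq> 0" "1 - s \<noteq> 0" if "s \<in> J" for s using that J by auto
  have m: "(m has_real_derivative \<kappa> s * m s) (at s)" if "s \<in> J" for s
  proof -
    have "((\<lambda>s. \<bar>s\<bar> powr e) has_real_derivative e * 1 / s * \<bar>s\<bar> powr e) (at s)"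
      using nz[OF that] by (intro DERIV_abs_powr) auto
    moreover have "((\<lambda>s. \<bar>1 - s\<bar> powr f) has_real_derivative f * (- 1) / (1 - s) * \<bar>1 - s\<bar> powr f) (at s)"
      using nz[OF that] by (intro DERIV_abs_powr) (auto intro!: derivative_eq_intros)
    ultimately have "(m has_real_derivative e * 1 / s * \<bar>s\<bar> powr e * \<bar>1 - s\<bar> powr f +
        f * (- 1) / (1 - s) * \<bar>1 - s\<bar> powr f * \<bar>s\<bar> powr e) (at s)"
      unfolding m_def[abs_def] by (rule DERIV_mult)
    then show ?thesis by (simp add: m_def \<kappa>_def algebra_simps)
  qed
  have \<kappa>: "(\<kappa> has_real_derivative - e / s\<^sup>2 - f / (1 - s)\<^sup>2) (at s)" if "s \<in> J" for s
    unfolding \<kappa>_def[abs_def] using nz[OF that]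
    by (auto intro!: derivative_eq_intros simp: power2_eq_square)
  have m_nz: "m s \<noteq> 0" if "s \<in> J" for s using nz[OF that] by (simp add: m_def)
  have coeff: "2 * \<kappa> s * \<psi>' s + \<psi>'' s + hg_P T (\<psi> s) * (\<psi>' s)\<^sup>2 = hg_P (a', b', c') s * \<psi>' s"
    "(\<kappa> s)\<^sup>2 + (- e / s\<^sup>2 - f / (1 - s)\<^sup>2) + hg_Q T (\<psi> s) * (\<psi>' s)\<^sup>2 =
      hg_P (a', b', c') s * \<kappa> s + hg_Q (a', b', c') s" if s: "s \<in> J" for s
    using hg_transported_coefficients[where T = T and m = m and \<kappa> = \<kappa> and \<psi> = \<psi> and \<psi>' = \<psi>', OF J(1-3) s \<psi>(1) \<psi>(2)[OF s] \<psi>(3) m \<kappa>[OF s] m_nz[OF s] rel[folded m_def]] by simp_all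
  have P': "hg_P (a', b', c') s = ((a' + b' + 1) * s - c') / (s * (1 - s))"
    and Q': "hg_Q (a', b', c') s = a' * b' / (s * (1 - s))" for s
    by (simp_all add: hg_P_def hg_Q_def)
  have "(2 * e + r0 + c') + (r1 - 2 * f - 2 * e - r0 - (a' + b' + 1)) * s + 0 * s\<^sup>2 = 0" if s: "s \<in> J" for s
  proof -
    define t where "t = 1 - s"
    have "(2 * \<kappa> s + (r0 / s + r1 / (1 - s)) - hg_P (a', b', c') s) * \<psi>' s = 0"
      using coeff(1)[OF s] r[OF s] by (simp add: algebra_simps)
    then have "2 * \<kappa> s + (r0 / s + r1 / (1 - s)) - hg_P (a', b', c') s = 0"
      using \<psi>(4)[OF s] by simp
    then have "(2 * \<kappa> s + (r0 / s + r1 / (1 - s)) - hg_P (a', b', c') s) * (s * t) = 0" by simp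
    moreover have "(2 * \<kappa> s + (r0 / s + r1 / (1 - s)) - hg_P (a', b', c') s) * (s * t) =
        2 * (e * t - f * s) + r0 * t + r1 * s - ((a' + b' + 1) * s - c')"
      using nz[OF s] unfolding \<kappa>_def P' t_def[symmetric] by (simp add: field_simps)
    ultimately show ?thesis unfolding t_def by (simp add: algebra_simps)
  qed
  note lin = quadratic_zero_on_open[OF J(1,4) this]
  have ef: "2 * e + r0 + c' = 0" "r1 - 2 * f - 2 * e - r0 - (a' + b' + 1) = 0"
    using lin(1,2) by auto
  show "e = - (r0 + c') / 2" using ef(1) by (simp add: field_simps)
  show "f = (r1 - (a' + b' + 1 - c')) / 2" using ef by (simp add: field_simps)
  define q1 where "q1 = - 2 * e * (e - 1) - 2 * e * f + k2 + k0 - k1 - (2 * c' * e + c' * f + (a' + b' + 1 - c') * e) - a' * b'"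
  define q2 where "q2 = e * (e - 1) + 2 * e * f + f * (f - 1) - k2 + (a' + b' + 1) * (e + f) + a' * b'"
  have "(e * (e - 1) + c' * e - k0) + q1 * s + q2 * s\<^sup>2 = 0" if s: "s \<in> J" for s
  proof -
    let ?B = "(\<kappa> s)\<^sup>2 + (- e / s\<^sup>2 - f / (1 - s)\<^sup>2) + (k2 / (s * (1 - s)) - k0 / (s\<^sup>2 * (1 - s)) - k1 / (s * (1 - s)\<^sup>2))
        - (hg_P (a', b', c') s * \<kappa> s + hg_Q (a', b', c') s)"
    define t where "t = 1 - s"
    have "?B = 0" using coeff(2)[OF s] k[OF s] by simp
    then have "?B * (s\<^sup>2 * t\<^sup>2) = 0" by simp
    moreover have "?B * (s\<^sup>2 * t\<^sup>2) = (e * t - f * s)\<^sup>2 - e * t\<^sup>2 - f * s\<^sup>2 + k2 * s * t - k0 * t - k1 * s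
        - (((a' + b' + 1) * s - c') * (e * t - f * s) + a' * b' * s * t)"
      using nz[OF s] unfolding \<kappa>_def P' Q' t_def[symmetric] by (simp add: field_simps power2_eq_square)
    ultimately show ?thesis
      unfolding q1_def q2_def t_def by (simp add: algebra_simps power2_eq_square)
  qed
  note q = quadratic_zero_on_open[OF J(1,4) this]
  show "e * (e - 1) + c' * e = k0" using q(1) by simp
  show "(e + f + a') * (e + f + b') = k2" using q(3) unfolding q2_def by (simp add: algebra_simps)
  show "f * (f - 1) + (a' + b' + 1 - c') * f = k1"
    using q unfolding q1_def q2_def by (simp add: algebra_simps)
qed

text \<open>The six tuples belong to \<open>s\<close>, \<open>1 - s\<close>, \<open>1/s\<close>, \<open>1 - 1/s\<close>, \<open>s/(s - 1)\<close> and \<open>1/(1 - s)\<close>, in this order. Where \<open>a b\<close> stands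
shows which of the points \<open>\<infinity>, 0, 1\<close> is mapped to \<open>\<infinity>\<close>.\<close>

lemma hg_related_equations:
  assumes J: "hg_interval J" and rel: "hg_related J (a, b, c) (a', b', c')"
  shows "\<exists>e f r0 r1 k0 k1 k2.
    (r0, r1, k0, k1, k2) \<in> {(- c, a + b + 1 - c, 0, 0, a * b), (c - (a + b + 1), c, 0, 0, a * b),
      (a + b - 1, a + b + 1 - c, a * b, 0, 0), (a + b - 1, c, a * b, 0, 0),
      (- c, 1 - a - b, 0, a * b, 0), (c - (a + b + 1), 1 - a - b, 0, a * b, 0)} \<and>
    e = - (r0 + c') / 2 \<and> f = (r1 - (a' + b' + 1 - c')) / 2 \<and>
    e * (e - 1) + c' * e = k0 \<and> f * (f - 1) + (a' + b' + 1 - c') * f = k1 \<and>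
    (e + f + a') * (e + f + b') = k2"
proof -
  have J': "open J" "0 \<notin> J" "1 \<notin> J" "J \<noteq> {}" using J by (auto simp: hg_interval_def)
  obtain \<alpha> \<beta> \<gamma> \<delta> e f where perm: "permutes_singular_points \<alpha> \<beta> \<gamma> \<delta>"
    and rel: "\<And>w. hg_solution (a, b, c) ((\<lambda>s. (\<alpha> * s + \<beta>) / (\<gamma> * s + \<delta>)) ` J) w \<Longrightarrow>
      hg_solution (a', b', c') J (\<lambda>s. \<bar>s\<bar> powr e * \<bar>1 - s\<bar> powr f * w ((\<alpha> * s + \<beta>) / (\<gamma> * s + \<delta>)))"
    using rel unfolding hg_related_def Let_def by blast
  have nz: "s \<noteq> 0" "s \<noteq> 1" "1 - s \<noteq> 0" if "s \<in> J" for s using that J' by auto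
  have rel': "hg_solution (a', b', c') J (\<lambda>s. \<bar>s\<bar> powr e * \<bar>1 - s\<bar> powr f * w (\<psi> s))"
    if "\<And>s. s \<noteq> 0 \<Longrightarrow> s \<noteq> 1 \<Longrightarrow> (\<alpha> * s + \<beta>) / (\<gamma> * s + \<delta>) = \<psi> s" and w: "hg_solution (a, b, c) (\<psi> ` J) w" for w \<psi>
  proof -
    have eq: "(\<alpha> * s + \<beta>) / (\<gamma> * s + \<delta>) = \<psi> s" if "s \<in> J" for s using that(1) that nz by (simp add: \<open>\<And>s. s \<noteq> 0 \<Longrightarrow> s \<noteq> 1 \<Longrightarrow> (\<alpha> * s + \<beta>) / (\<gamma> * s + \<delta>) = \<psi> s\<close>)
    then have "(\<lambda>s. (\<alpha> * s + \<beta>) / (\<gamma> * s + \<delta>)) ` J = \<psi> ` J" by (intro image_cong) auto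
    from rel[unfolded this, OF w] show ?thesis
      by (subst hg_solution_cong[OF J'(1-3)]) (auto simp: eq)
  qed
  have P: "hg_P (a, b, c) x = ((a + b + 1) * x - c) / (x * (1 - x))" and Q: "hg_Q (a, b, c) x = a * b / (x * (1 - x))" for x
    by (simp_all add: hg_P_def hg_Q_def)
  have main: ?thesis
    if side: "\<And>s. s \<noteq> 0 \<Longrightarrow> s \<noteq> 1 \<Longrightarrow> (\<alpha> * s + \<beta>) / (\<gamma> * s + \<delta>) = \<psi> s"
      "\<And>s. s \<noteq> 0 \<Longrightarrow> 1 - s \<noteq> 0 \<Longrightarrow> (\<psi> has_real_derivative \<psi>' s) (at s)"
      "\<And>s. s \<noteq> 0 \<Longrightarrow> 1 - s \<noteq> 0 \<Longrightarrow> (\<psi>' has_real_derivative \<psi>'' s) (at s)"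
      "\<And>s. s \<noteq> 0 \<Longrightarrow> 1 - s \<noteq> 0 \<Longrightarrow> (\<psi> s \<noteq> 0 \<and> \<psi> s \<noteq> 1) \<and> \<psi>' s \<noteq> 0"
      "\<And>s. s \<noteq> 0 \<Longrightarrow> 1 - s \<noteq> 0 \<Longrightarrow> \<psi>'' s + ((a + b + 1) * \<psi> s - c) / (\<psi> s * (1 - \<psi> s)) * (\<psi>' s)\<^sup>2 = (r0 / s + r1 / (1 - s)) * \<psi>' s"
      "\<And>s. s \<noteq> 0 \<Longrightarrow> 1 - s \<noteq> 0 \<Longrightarrow> a * b / (\<psi> s * (1 - \<psi> s)) * (\<psi>' s)\<^sup>2 =
        k2 / (s * (1 - s)) - k0 / (s\<^sup>2 * (1 - s)) - k1 / (s * (1 - s)\<^sup>2)"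
      "(r0, r1, k0, k1, k2) \<in> {(- c, a + b + 1 - c, 0, 0, a * b), (c - (a + b + 1), c, 0, 0, a * b),
      (a + b - 1, a + b + 1 - c, a * b, 0, 0), (a + b - 1, c, a * b, 0, 0),
      (- c, 1 - a - b, 0, a * b, 0), (c - (a + b + 1), 1 - a - b, 0, a * b, 0)}"
    for \<psi> \<psi>' \<psi>'' r0 r1 k0 k1 k2
  proof -
    have nz': "s \<noteq> 0" "1 - s \<noteq> 0" if "s \<in> J" for s using nz[OF that] by blast+
    have pre: "(\<psi> has_real_derivative \<psi>' s) (at s)" "(\<psi>' has_real_derivative \<psi>'' s) (at s)"
      "\<psi> s \<noteq> 0 \<and> \<psi> s \<noteq> 1" "\<psi>' s \<noteq> 0"
      "\<psi>'' s + hg_P (a, b, c) (\<psi> s) * (\<psi>' s)\<^sup>2 = (r0 / s + r1 / (1 - s)) * \<psi>' s"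
      "hg_Q (a, b, c) (\<psi> s) * (\<psi>' s)\<^sup>2 =
        k2 / (s * (1 - s)) - k0 / (s\<^sup>2 * (1 - s)) - k1 / (s * (1 - s)\<^sup>2)" if "s \<in> J" for s
      unfolding P Q by (fact side(2)[OF nz'[OF that]] side(3)[OF nz'[OF that]]
        conjunct1[OF side(4)[OF nz'[OF that]]] conjunct2[OF side(4)[OF nz'[OF that]]]
        side(5)[OF nz'[OF that]] side(6)[OF nz'[OF that]])+
    have "e = - (r0 + c') / 2 \<and> f = (r1 - (a' + b' + 1 - c')) / 2 \<and>
        e * (e - 1) + c' * e = k0 \<and> f * (f - 1) + (a' + b' + 1 - c') * f = k1 \<and>
        (e + f + a') * (e + f + b') = k2"
      by (intro conjI; rule hg_exponent_equations[OF J' pre(1) pre(2) pre(3) pre(4) rel'[OF side(1)] pre(5) pre(6)])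
    with side(7) show ?thesis by blast
  qed
  have d0: "((\<lambda>s::real. 1 / s) has_real_derivative - (1 / s\<^sup>2)) (at s)" if "s \<noteq> 0" for s :: real
    using that by (auto intro!: derivative_eq_intros simp: power2_eq_square)
  have d1: "((\<lambda>s::real. 1 / s\<^sup>2) has_real_derivative - (2 / s ^ 3)) (at s)" if "s \<noteq> 0" for s :: real
    using that by (auto intro!: derivative_eq_intros simp: divide_simps) (simp add: eval_nat_numeral)
  have d2: "((\<lambda>s::real. 1 / (1 - s)) has_real_derivative 1 / (1 - s)\<^sup>2) (at s)" if "1 - s \<noteq> 0" for s :: real
    using that by (auto intro!: derivative_eq_intros simp: power2_eq_square)
  have d3: "((\<lambda>s::real. 1 / (1 - s)\<^sup>2) has_real_derivative 2 / (1 - s) ^ 3) (at s)" if "1 - s \<noteq> 0" for s :: real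
    using that by (auto intro!: derivative_eq_intros simp: divide_simps) (simp add: eval_nat_numeral)
  from perm show ?thesis
  proof (cases rule: six_substitutions)
    case id
    show ?thesis
      by (rule main[OF id, where \<psi>' = "\<lambda>_. 1" and \<psi>'' = "\<lambda>_. 0" and ?r0.0 = "- c" and ?r1.0 = "a + b + 1 - c" and ?k0.0 = 0 and ?k1.0 = 0 and ?k2.0 = "a * b"])
        (simp_all add: field_simps)
  next
    case flip
    show ?thesis
      by (rule main[OF flip, where \<psi>' = "\<lambda>_. - 1" and \<psi>'' = "\<lambda>_. 0" and ?r0.0 = "c - (a + b + 1)" and ?r1.0 = c and ?k0.0 = 0 and ?k1.0 = 0 and ?k2.0 = "a * b"])
        (auto intro!: derivative_eq_intros simp: field_simps)
  next
    case inv
    have d: "((\<lambda>s. 1 / s) has_real_derivative - (1 / s\<^sup>2)) (at s)"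
      "((\<lambda>s. - (1 / s\<^sup>2)) has_real_derivative 2 / s ^ 3) (at s)" if "s \<noteq> 0" "1 - s \<noteq> 0" for s
      using d0[OF that(1)] DERIV_minus[OF d1[OF that(1)]] by simp_all
    show ?thesis
      apply (rule main[OF inv d, where ?r0.0 = "a + b - 1" and ?r1.0 = "a + b + 1 - c"
            and ?k0.0 = "a * b" and ?k1.0 = "0" and ?k2.0 = 0])
      apply (simp_all add: divide_simps power2_eq_square power3_eq_cube)
      apply (simp_all add: algebra_simps)
      done
  next
    case flip_inv
    have d: "((\<lambda>s. 1 - 1 / s) has_real_derivative 1 / s\<^sup>2) (at s)"
      "((\<lambda>s. 1 / s\<^sup>2) has_real_derivative - (2 / s ^ 3)) (at s)" if "s \<noteq> 0" "1 - s \<noteq> 0" for s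
      using DERIV_diff[OF DERIV_const d0[OF that(1)], of 1] d1[OF that(1)] by simp_all
    show ?thesis
      apply (rule main[OF flip_inv d, where ?r0.0 = "a + b - 1" and ?r1.0 = "c"
            and ?k0.0 = "a * b" and ?k1.0 = "0" and ?k2.0 = 0])
      apply (simp_all add: divide_simps power2_eq_square power3_eq_cube)
      apply (simp_all add: algebra_simps)
      done
  next
    case pfaff
    have d: "((\<lambda>s. 1 - 1 / (1 - s)) has_real_derivative - (1 / (1 - s)\<^sup>2)) (at s)"
      "((\<lambda>s. - (1 / (1 - s)\<^sup>2)) has_real_derivative - (2 / (1 - s) ^ 3)) (at s)" if "s \<noteq> 0" "1 - s \<noteq> 0" for s
      using DERIV_diff[OF DERIV_const d2[OF that(2)], of 1] DERIV_minus[OF d3[OF that(2)]] by simp_all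
    show ?thesis
      apply (rule main[OF pfaff d, where ?r0.0 = "- c" and ?r1.0 = "1 - a - b"
            and ?k0.0 = "0" and ?k1.0 = "a * b" and ?k2.0 = 0])
      apply (simp_all add: divide_simps power2_eq_square power3_eq_cube)
      apply (simp_all add: algebra_simps)
      done
  next
    case inv_flip
    have d: "((\<lambda>s. 1 / (1 - s)) has_real_derivative 1 / (1 - s)\<^sup>2) (at s)"
      "((\<lambda>s. 1 / (1 - s)\<^sup>2) has_real_derivative 2 / (1 - s) ^ 3) (at s)" if "s \<noteq> 0" "1 - s \<noteq> 0" for s
      using d2[OF that(2)] d3[OF that(2)] by simp_all
    show ?thesis
      apply (rule main[OF inv_flip d, where ?r0.0 = "c - (a + b + 1)" and ?r1.0 = "1 - a - b"
            and ?k0.0 = "0" and ?k1.0 = "a * b" and ?k2.0 = 0])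
      apply (simp_all add: divide_simps power2_eq_square power3_eq_cube)
      apply (simp_all add: algebra_simps)
      done
  qed
qed

lemma hg_relatedI:
  assumes J: "hg_interval J" and perm: "permutes_singular_points \<alpha> \<beta> \<gamma> \<delta>"
    and \<phi>: "\<And>s. (\<alpha> * s + \<beta>) / (\<gamma> * s + \<delta>) = \<phi> s"
    and sol: "\<And>w. hg_solution T (\<phi> ` J) w \<longleftrightarrow> hg_solution T' J (\<lambda>s. w (\<phi> s))"
  shows "hg_related J T T'"
proof -
  have J': "open J" "0 \<notin> J" "1 \<notin> J" using J by (auto simp: hg_interval_def)
  have "hg_solution T' J (\<lambda>s. w (\<phi> s)) \<longleftrightarrow>
      hg_solution T' J (\<lambda>s. \<bar>s\<bar> powr 0 * \<bar>1 - s\<bar> powr 0 * w (\<phi> s))" for w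
  proof (rule hg_solution_cong[OF J'])
    fix s assume "s \<in> J"
    with J' have "s \<noteq> 0" "1 - s \<noteq> 0" by auto
    then show "w (\<phi> s) = \<bar>s\<bar> powr 0 * \<bar>1 - s\<bar> powr 0 * w (\<phi> s)" by simp
  qed
  with sol perm show ?thesis
    unfolding hg_related_def Let_def \<phi>[symmetric] by blast
qed

lemma hg_related_refl:
  assumes "hg_interval J"
  shows "hg_related J T T"
  by (rule hg_relatedI[OF assms, of 1 0 0 1 "\<lambda>s. s"])
    (simp_all add: permutes_singular_points_def marked_point_def)

text \<open>The reflection \<open>s \<mapsto> 1 - s\<close> exchanges the singular points \<open>0\<close> and \<open>1\<close>, that is, \<open>c\<close> and \<open>a + b + 1 - c\<close>.\<close>

lemma hg_solution_flip:
  assumes J: "open J" "0 \<notin> J" "1 \<notin> J"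
    and w: "hg_solution (a, b, c) ((\<lambda>s. 1 - s) ` J) w"
  shows "hg_solution (a, b, a + b + 1 - c) J (\<lambda>s. w (1 - s))"
proof (rule hg_solutionI(1)[OF J, where z = "\<lambda>s. - deriv w (1 - s)"])
  fix s assume s: "s \<in> J"
  have J': "0 \<notin> (\<lambda>s. 1 - s) ` J" "1 \<notin> (\<lambda>s. 1 - s) ` J" using J by auto
  have d: "((\<lambda>s. 1 - s) has_real_derivative - 1) (at s)" by (auto intro!: derivative_eq_intros)
  note D = hg_solutionD[OF w J' imageI[OF s]]
  show "((\<lambda>s. w (1 - s)) has_real_derivative - deriv w (1 - s)) (at s)"
    using DERIV_chain2[OF D(1) d] by simp
  have "((\<lambda>s. - deriv w (1 - s)) has_real_derivative
      hg_P (a, b, c) (1 - s) * deriv w (1 - s) + hg_Q (a, b, c) (1 - s) * w (1 - s)) (at s)"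
    using DERIV_minus[OF DERIV_chain2[OF D(2) d]] by (simp add: add.commute)
  moreover have "hg_P (a, b, c) (1 - s) = - hg_P (a, b, a + b + 1 - c) s"
    "hg_Q (a, b, c) (1 - s) = hg_Q (a, b, a + b + 1 - c) s"
  proof -
    have num: "(a + b + 1) * (1 - s) - c = - ((a + b + 1) * s - (a + b + 1 - c))"
      and den: "(1 - s) * (1 - (1 - s)) = s * (1 - s)" by (simp_all add: algebra_simps)
    show "hg_P (a, b, c) (1 - s) = - hg_P (a, b, a + b + 1 - c) s"
      unfolding hg_P_def prod.case num den by (rule minus_divide_left[symmetric])
    show "hg_Q (a, b, c) (1 - s) = hg_Q (a, b, a + b + 1 - c) s"
      unfolding hg_Q_def prod.case den ..
  qed
  ultimately show "((\<lambda>s. - deriv w (1 - s)) has_real_derivative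
      hg_P (a, b, a + b + 1 - c) s * - deriv w (1 - s) + hg_Q (a, b, a + b + 1 - c) s * w (1 - s)) (at s)"
    by simp
qed

text \<open>The converse implication between solutions is again a reflection, from the reflected interval.\<close>

lemma hg_related_flip:
  assumes "hg_interval J"
  shows "hg_related J (a, b, c) (a, b, a + b + 1 - c)"
proof -
  have J: "open J" "0 \<notin> J" "1 \<notin> J" using assms by (auto simp: hg_interval_def)
  let ?J = "(\<lambda>s. 1 - s) ` J"
  have "x \<in> ?J \<longleftrightarrow> 1 - x \<in> J" for x
    by (auto intro: image_eqI[where x = "1 - x"])
  then have "?J = (\<lambda>s. 1 - s) -` J" by blast
  then have J': "open ?J" "0 \<notin> ?J" "1 \<notin> ?J"
    using J by (auto intro!: open_vimage continuous_intros)
  have "hg_solution (a, b, c) ?J w \<longleftrightarrow> hg_solution (a, b, a + b + 1 - c) J (\<lambda>s. w (1 - s))" for w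
    using hg_solution_flip[OF J, of a b c w] hg_solution_flip[OF J', of a b "a + b + 1 - c" "\<lambda>s. w (1 - s)"]
    by (auto simp: image_image)
  then show ?thesis
    by (intro hg_relatedI[OF assms, of "- 1" 1 0 1 "\<lambda>s. 1 - s"])
      (simp_all add: permutes_singular_points_def marked_point_def)
qed

text \<open>For each of the six substitutions \<open>e\<close> and \<open>f\<close> are determined, and then one of the remaining equations between
numbers is false: the exponent difference \<open>4/3\<close> occurs for one of the two triples only.\<close>

lemma hg_not_related:
  assumes J: "hg_interval J"
  shows "\<not> hg_related J (- 1/4, 5/12, 1/2) (- 1/2, 5/6, 2/3)"
    "\<not> hg_related J (- 1/4, 5/12, 2/3) (- 1/2, 5/6, 2/3)"
    "\<not> hg_related J (- 1/2, 5/6, 2/3) (- 1/4, 5/12, 1/2)"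
    "\<not> hg_related J (- 1/2, 5/6, 2/3) (- 1/4, 5/12, 2/3)"
proof -
  show "\<not> hg_related J (- 1/4, 5/12, 1/2) (- 1/2, 5/6, 2/3)"
    by (rule notI, drule hg_related_equations[OF J], elim exE conjE insertE emptyE; unfold prod.inject; elim conjE; hypsubst; simp)
  show "\<not> hg_related J (- 1/4, 5/12, 2/3) (- 1/2, 5/6, 2/3)"
    by (rule notI, drule hg_related_equations[OF J], elim exE conjE insertE emptyE; unfold prod.inject; elim conjE; hypsubst; simp)
  show "\<not> hg_related J (- 1/2, 5/6, 2/3) (- 1/4, 5/12, 1/2)"
    by (rule notI, drule hg_related_equations[OF J], elim exE conjE insertE emptyE; unfold prod.inject; elim conjE; hypsubst; simp)
  show "\<not> hg_related J (- 1/2, 5/6, 2/3) (- 1/4, 5/12, 2/3)"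
    by (rule notI, drule hg_related_equations[OF J], elim exE conjE insertE emptyE; unfold prod.inject; elim conjE; hypsubst; simp)
qed

section \<open>The classes and the main result\<close>

lemma two_class_quotient:
  assumes A: "A = {x, y, z}" and ne: "x \<noteq> z" "y \<noteq> z" and r: "r = {x, y} \<times> {x, y} \<union> {(z, z)}"
  shows "equiv A r" "A // r = {r `` {y}, r `` {z}}" "card (A // r) = 2"
proof -
  show "equiv A r"
    unfolding A r by (intro equivI refl_onI symI transI) (use ne in auto)
  have c: "r `` {x} = {x, y}" "r `` {y} = {x, y}" "r `` {z} = {z}"
    unfolding r using ne by auto
  have "A // r = {r `` {x}, r `` {y}, r `` {z}}"
    unfolding A quotient_def by auto
  then show q: "A // r = {r `` {y}, r `` {z}}"
    unfolding c by simp
  show "card (A // r) = 2"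
    unfolding q c using ne by (auto simp: card_insert_if)
qed

lemma two_class_relation:
  assumes "\<And>u. R u u" "R x y" "R y x" "\<not> R x z" "\<not> R y z" "\<not> R z x" "\<not> R z y"
  shows "{(u, v). u \<in> {x, y, z} \<and> v \<in> {x, y, z} \<and> R u v} = {x, y} \<times> {x, y} \<union> {(z, z)}"
  using assms by blast

lemma hg_class_eq:
  assumes J: "hg_interval J"
  shows "hg_class J = {(- 1/4, 5/12, 1/2), (- 1/4, 5/12, 2/3)} \<times> {(- 1/4, 5/12, 1/2), (- 1/4, 5/12, 2/3)}
    \<union> {((- 1/2, 5/6, 2/3), (- 1/2, 5/6, 2/3))}"
proof -
  define T1 T2 T3 :: "real \<times> real \<times> real"
    where "T1 = (- 1/4, 5/12, 1/2)" and "T2 = (- 1/4, 5/12, 2/3)" and "T3 = (- 1/2, 5/6, 2/3)"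
  note T = T1_def[symmetric] T2_def[symmetric] T3_def[symmetric]
  have "- 1/4 + 5/12 + 1 - 1/2 = (2/3 :: real)" "- 1/4 + 5/12 + 1 - 2/3 = (1/2 :: real)" by simp_all
  then have "hg_related J T1 T2" "hg_related J T2 T1"
    using hg_related_flip[OF J, of "- 1/4" "5/12" "1/2"] hg_related_flip[OF J, of "- 1/4" "5/12" "2/3"]
    by (simp_all only: T1_def T2_def)
  moreover have "\<not> hg_related J T1 T3" "\<not> hg_related J T2 T3" "\<not> hg_related J T3 T1" "\<not> hg_related J T3 T2"
    using hg_not_related[OF J] unfolding T .
  ultimately show ?thesis
    unfolding hg_class_def hg_triples_def T
    by (intro two_class_relation hg_related_refl[OF J])
qed

theorem hg_classes:
  assumes J: "hg_interval J"
  shows "equiv hg_triples (hg_class J)"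
    "hg_triples // hg_class J = {hg_class J `` {(- 1/4, 5/12, 2/3)}, hg_class J `` {(- 1/2, 5/6, 2/3)}}"
    "card (hg_triples // hg_class J) = 2"
  by (rule two_class_quotient[OF hg_triples_def _ _ hg_class_eq[OF J]]; simp)+

theorem proposition6p7:
  shows "(\<forall>T\<in>hg_triples. \<forall>J w1 w2 I K.
            hg_interval J \<and>
            hg_solution T J w1 \<and> hg_solution T J w2 \<and> lin_indep_on J w1 w2 \<and>
            (\<forall>s\<in>J. w1 s \<noteq> 0 \<and> wronskian w1 w2 s \<noteq> 0) \<and>
            antiderivatives_on J w1 w2 I K
            \<longrightarrow> pseudo_metric_on {q. q $ 5 \<in> J} (nurowski_metric w1 w2 I K) \<and>
                conformally_flat_on {q. q $ 5 \<in> J} (nurowski_metric w1 w2 I K))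
       \<and> (\<forall>T\<in>hg_triples. \<forall>J. hg_interval J \<longrightarrow> four_dim_family J (hg_pairs T J))
       \<and> (\<forall>J. hg_interval J \<longrightarrow>
            equiv hg_triples (hg_class J) \<and>
            hg_triples // hg_class J =
              {hg_class J `` {(- 1/4, 5/12, 2/3)}, hg_class J `` {(- 1/2, 5/6, 2/3)}} \<and>
            card (hg_triples // hg_class J) = 2)"
proof (intro conjI ballI allI impI)
  fix T J w1 w2 I K
  assume "T \<in> hg_triples" and "hg_interval J \<and> hg_solution T J w1 \<and> hg_solution T J w2 \<and> lin_indep_on J w1 w2 \<and>
    (\<forall>s\<in>J. w1 s \<noteq> 0 \<and> wronskian w1 w2 s \<noteq> 0) \<and> antiderivatives_on J w1 w2 I K"
  then show "pseudo_metric_on {q. q $ 5 \<in> J} (nurowski_metric w1 w2 I K)"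
    "conformally_flat_on {q. q $ 5 \<in> J} (nurowski_metric w1 w2 I K)"
    using nurowski_conformally_flat[of T J w1 w2 I K] by blast+
qed (rule four_dim_family_hg_pairs hg_classes; assumption)+

end
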